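(* Let $(K,v)$ be a valued field with $\mathrm{rk}\, vK=n$ a finite positive integer, let $\overline v$ be an extension of $v$ to an algebraic closure $\overline K$ of $K$, and identify $\overline v\overline K$ with $(\Gamma_1\oplus\dots\oplus\Gamma_n)_{\mathrm{lex}}$, where the $\Gamma_i$ are subgroups of $\mathbb R$. Let $E=\{z_\nu\}_{\nu<\lambda}$ be a pseudo divergent sequence in $(K,v)$ and write $\delta_\nu=(\delta_{1,\nu},\dots,\delta_{n,\nu})$ for $1\le\nu<\lambda$. Put $\nu_0:=1$. Let $1\le i\le n$ and suppose that for each $1\le j<i$ there are $r_j'\in\Gamma_j$ and $\nu_j$ with $\nu_{j-1}\le\nu_j<\lambda$ such that $\inf\{\delta_{j,\nu}\}_{\nu\ge\nu_{j-1}}=r_j'=\delta_{j,\nu}$ for all $\nu\ge\nu_j$ (no condition if $i=1$). Let $r_i':=\inf\{\delta_{i,\nu}\}_{\nu\ge\nu_{i-1}}\in\mathbb R\cup\{-\infty\}$. Then: (a) if $r_i'=-\infty$, then $\mathrm{rk}\, v_EK(X)=\mathrm{rk}\, vK+1$; (b) if $r_i'\in\mathbb R\setminus\Gamma_i$, then $\mathrm{rk}\, v_EK(X)=\mathrm{rk}\, vK$; (c) if $r_i'\in\Gamma_i$ and $r_i'<\delta_{i,\nu}$ for all $\nu\ge\nu_{i-1}$, then $\mathrm{rk}\, v_EK(X)=\mathrm{rk}\, vK+1$; (d) otherwise $r_i'\in\Gamma_i$ and there is $\nu_i$ with $\nu_{i-1}\le\nu_i<\lambda$ and $r_i'=\delta_{i,\nu}$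 for all $\nu\ge\nu_i$ (so the procedure continues with $i+1$); this last case does not occur for $i=n$.
   Context: Conventions. A valued field $(K,v)$ is a field with a (Krull) valuation, value group $vK$ (written additively). The rank $\mathrm{rk}\,\Gamma$ of an ordered abelian group $\Gamma$ is the order type of the set, ordered by inclusion, of its isolated subgroups, i.e. of the proper subgroups $\Delta$ such that $\alpha\in\Delta$, $\beta\in\Gamma$, $-\alpha\le\beta\le\alpha$ imply $\beta\in\Delta$. If $\mathrm{rk}\, vK=n$ is a positive integer, then $\overline v\overline K$ is order isomorphic to $(\Gamma_1\oplus\dots\oplus\Gamma_n)_{\mathrm{lex}}$ (lexicographic order) for some subgroups $\Gamma_i$ of $\mathbb R$. Let $\lambda$ be a limit ordinal. $E=\{z_\nu\}_{\nu<\lambda}\subseteq K$ is pseudo divergent if $v(z_{\nu_1}-z_{\nu_2})>v(z_{\nu_2}-z_{\nu_3})$ for all $\nu_1<\nu_2<\nu_3<\lambda$; then $\delta_\nu:=v(z_\nu-z_\mu)$ for any $\mu<\nu$ (independent of $\mu$; $\nu\ge 1$), all of which are taken to lie in $vK$. $v_E$ is the valuation of $K(X)$ with valuation ring $\{\phi\in K(X)\mid v\phi(z_\nu)\ge 0$ for all sufficiently large $\nu\}$ (maximal ideal given by $v\phi(z_\nu)>0$ for all sufficiently large $\nu$); it extends $v$, and $v_EK(X)$ is its value group. *)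

theory Defs
  imports
    "HOL-Computational_Algebra.Computational_Algebra"
    "HOL-Library.Extended_Real"
    "HOL-Library.Fun_Lexorder"
begin

section \<open>Ordered abelian groups and rank\<close>

text \<open>Value groups are carried by subgroups of a linearly ordered abelian group type.\<close>

definition is_subgroup :: "'g::ab_group_add set \<Rightarrow> bool" where
  "is_subgroup H \<longleftrightarrow> 0 \<in> H \<and> (\<forall>a\<in>H. \<forall>b\<in>H. a + b \<in> H) \<and> (\<forall>a\<in>H. - a \<in> H)"

definition isolated_subgroups :: "'g::linordered_ab_group_add set \<Rightarrow> 'g set set" where
  "isolated_subgroups G =
     {D. is_subgroup D \<and> D \<subset> G \<and> (\<forall>a\<in>D. \<forall>b\<in>G. - a \<le> b \<and> b \<le> a \<longrightarrow> b \<in> D)}"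

text \<open>The order type of the set of isolated subgroups, ordered by inclusion, is the
  finite ordinal \<open>n\<close>.\<close>

definition has_rank :: "'g::linordered_ab_group_add set \<Rightarrow> nat \<Rightarrow> bool" where
  "has_rank G n \<longleftrightarrow>
     (\<exists>f. bij_betw f {..<n} (isolated_subgroups G) \<and>
          (\<forall>i<n. \<forall>j<n. i \<le> j \<longleftrightarrow> f i \<subseteq> f j))"

text \<open>Elements of the lexicographic sum of \<open>G 1, \<dots>, G n\<close> are sequences extended by 0 outside
  \<open>{1..n}\<close>, so that \<^const>\<open>less_fun\<close> is their lexicographic order.\<close>

definition lex_sum :: "nat \<Rightarrow> (nat \<Rightarrow> real set) \<Rightarrow> (nat \<Rightarrow> real) set" where
  "lex_sum n G = {x. (\<forall>i\<in>{1..n}. x i \<in> G i) \<and> (\<forall>i. i \<notin> {1..n} \<longrightarrow> x i = 0)}"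

definition lex_iso ::
  "'g::linordered_ab_group_add set \<Rightarrow> nat \<Rightarrow> (nat \<Rightarrow> real set) \<Rightarrow> ('g \<Rightarrow> nat \<Rightarrow> real) \<Rightarrow> bool" where
  "lex_iso H n G \<theta> \<longleftrightarrow>
     bij_betw \<theta> H (lex_sum n G) \<and>
     (\<forall>a\<in>H. \<forall>b\<in>H. \<theta> (a + b) = (\<lambda>i. \<theta> a i + \<theta> b i)) \<and>
     (\<forall>a\<in>H. \<forall>b\<in>H. a < b \<longleftrightarrow> less_fun (\<theta> a) (\<theta> b))"


section \<open>Krull valuations\<close>

text \<open>The value of a valuation at 0 is \<open>\<infinity>\<close>; here it is left unspecified, and every use of
  \<open>v x\<close> is guarded by \<open>x \<noteq> 0\<close>.\<close>

definition valuation :: "('a::field \<Rightarrow> 'g::linordered_ab_group_add) \<Rightarrow> bool" where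
  "valuation v \<longleftrightarrow>
     (\<forall>x y. x \<noteq> 0 \<longrightarrow> y \<noteq> 0 \<longrightarrow> v (x * y) = v x + v y) \<and>
     (\<forall>x y. x \<noteq> 0 \<longrightarrow> y \<noteq> 0 \<longrightarrow> x + y \<noteq> 0 \<longrightarrow> min (v x) (v y) \<le> v (x + y))"

definition value_group :: "('a::field \<Rightarrow> 'g::linordered_ab_group_add) \<Rightarrow> 'g set" where
  "value_group v = v ` (UNIV - {0})"

definition valuation_ring :: "('a::field \<Rightarrow> 'g::linordered_ab_group_add) \<Rightarrow> 'a set" where
  "valuation_ring v = {x. x = 0 \<or> 0 \<le> v x}"

definition algebraic_closure_via :: "('a::field \<Rightarrow> 'b::alg_closed_field) \<Rightarrow> bool" where
  "algebraic_closure_via \<iota> \<longleftrightarrow>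
     \<iota> 1 = 1 \<and> (\<forall>x y. \<iota> (x + y) = \<iota> x + \<iota> y) \<and> (\<forall>x y. \<iota> (x * y) = \<iota> x * \<iota> y) \<and>
     (\<forall>y. \<exists>p. p \<noteq> 0 \<and> poly (map_poly \<iota> p) y = 0)"

definition extends_valuation ::
  "('a::field \<Rightarrow> 'b::field) \<Rightarrow> ('a \<Rightarrow> 'g::linordered_ab_group_add) \<Rightarrow> ('b \<Rightarrow> 'g) \<Rightarrow> bool" where
  "extends_valuation \<iota> v w \<longleftrightarrow> valuation w \<and> (\<forall>x. x \<noteq> 0 \<longrightarrow> w (\<iota> x) = v x)"


section \<open>Pseudo divergent sequences\<close>

text \<open>A limit ordinal \<open>\<lambda>\<close> is represented by a well-ordered index type without greatest element.
  The first clause says that all the values \<open>v (z \<nu> - z \<mu>)\<close> are finite.\<close>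

definition pseudo_divergent ::
  "('a::field \<Rightarrow> 'g::linordered_ab_group_add) \<Rightarrow> ('o::{wellorder,no_top} \<Rightarrow> 'a) \<Rightarrow> bool" where
  "pseudo_divergent v z \<longleftrightarrow>
     (\<forall>\<mu> \<nu>. \<mu> < \<nu> \<longrightarrow> z \<nu> \<noteq> z \<mu>) \<and>
     (\<forall>\<nu>1 \<nu>2 \<nu>3. \<nu>1 < \<nu>2 \<longrightarrow> \<nu>2 < \<nu>3 \<longrightarrow> v (z \<nu>1 - z \<nu>2) > v (z \<nu>2 - z \<nu>3))"

text \<open>The index 1, i.e. the least index having a predecessor.\<close>

definition index_one :: "'o::{wellorder,no_top}" where
  "index_one = (LEAST \<nu>. \<exists>\<mu>. \<mu> < \<nu>)"

text \<open>The choice of \<open>\<mu> < \<nu>\<close> is immaterial, see \<open>gauge_eq\<close> below; \<open>gauge v z \<nu>\<close> is meaningful only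
  for \<open>\<nu> \<ge> index_one\<close>.\<close>

definition gauge ::
  "('a::field \<Rightarrow> 'g::linordered_ab_group_add) \<Rightarrow> ('o::{wellorder,no_top} \<Rightarrow> 'a) \<Rightarrow> 'o \<Rightarrow> 'g" where
  "gauge v z \<nu> = v (z \<nu> - z (SOME \<mu>. \<mu> < \<nu>))"

lemma index_one_le_iff: "index_one \<le> \<nu> \<longleftrightarrow> (\<exists>\<mu>. \<mu> < \<nu>)"
proof
  have "\<exists>\<nu>::'a. \<exists>\<mu>. \<mu> < \<nu>" using gt_ex by blast
  then have "\<exists>\<mu>. \<mu> < (index_one::'a)"
    unfolding index_one_def by (rule LeastI_ex)
  then show "index_one \<le> \<nu> \<Longrightarrow> \<exists>\<mu>. \<mu> < \<nu>" by (meson less_le_trans)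
  show "\<exists>\<mu>. \<mu> < \<nu> \<Longrightarrow> index_one \<le> \<nu>" unfolding index_one_def by (rule Least_le)
qed

lemma valuation_minus:
  assumes "valuation v" and "x \<noteq> 0"
  shows "v (- x) = v x"
proof -
  have mult: "v (a * b) = v a + v b" if "a \<noteq> 0" "b \<noteq> 0" for a b
    using assms that unfolding valuation_def by blast
  have "v (- 1) + v (- 1) = 0"
    using mult[of "- 1" "- 1"] mult[of 1 1] by simp
  then have "v (- 1) = 0" by simp
  then show ?thesis using mult[of "- 1" x] assms by simp
qed

lemma valuation_add_eq:
  assumes v: "valuation v" and nz: "x \<noteq> 0" "y \<noteq> 0" and less: "v y < v x"
  shows "v (x + y) = v y"
proof -
  have ne: "x + y \<noteq> 0"
    using valuation_minus[OF v nz(2)] less by (metis eq_neg_iff_add_eq_0 less_irrefl)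
  have add: "min (v a) (v b) \<le> v (a + b)" if "a \<noteq> 0" "b \<noteq> 0" "a + b \<noteq> 0" for a b
    using v that unfolding valuation_def by blast
  have "v y \<le> v (x + y)" using add[OF nz ne] less by (simp add: min_def split: if_splits)
  moreover have "min (v (x + y)) (v x) \<le> v y"
    using add[of "x + y" "- x"] ne nz valuation_minus[OF v nz(1)] by simp
  ultimately show ?thesis using less by (simp add: min_def split: if_splits)
qed

lemma gauge_eq:
  assumes v: "valuation v" and z: "pseudo_divergent v z" and "\<mu> < \<nu>"
  shows "gauge v z \<nu> = v (z \<nu> - z \<mu>)"
proof -
  have nz: "z b - z a \<noteq> 0" "z a - z b \<noteq> 0" if "a < b" for a b
    using z that unfolding pseudo_divergent_def by force+
  have step: "v (z \<nu> - z a) = v (z \<nu> - z b)" if "a < b" "b < \<nu>" for a b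
  proof -
    have "v (z b - z \<nu>) < v (z a - z b)"
      using z that unfolding pseudo_divergent_def by blast
    then have "v ((z a - z b) + (z b - z \<nu>)) = v (z b - z \<nu>)"
      using valuation_add_eq[OF v] nz that by blast
    then have "v (z a - z \<nu>) = v (z b - z \<nu>)" by simp
    then show ?thesis
      using valuation_minus[OF v] nz that by (metis less_trans minus_diff_eq)
  qed
  have "(SOME \<mu>. \<mu> < \<nu>) < \<nu>" using \<open>\<mu> < \<nu>\<close> by (rule someI)
  then show ?thesis unfolding gauge_def using step \<open>\<mu> < \<nu>\<close> by (metis linorder_neqE)
qed


section \<open>The valuation of the rational function field attached to a sequence\<close>

text \<open>\<open>K(X)\<close> is the type \<open>'a poly fract\<close>. A rational function \<open>\<phi>\<close> has the value \<open>b\<close> at \<open>a\<close> if some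
  representation of \<open>\<phi>\<close> as a quotient has no pole at \<open>a\<close> and evaluates to \<open>b\<close>.\<close>

definition has_value_at :: "'a::field poly fract \<Rightarrow> 'a \<Rightarrow> 'a \<Rightarrow> bool" where
  "has_value_at \<phi> a b \<longleftrightarrow>
     (\<exists>p q. \<phi> = Fract p q \<and> poly q a \<noteq> 0 \<and> b = poly p a / poly q a)"

lemma has_value_at_unique:
  assumes "has_value_at \<phi> a b" and "has_value_at \<phi> a c"
  shows "b = c"
proof -
  obtain p q where 1: "\<phi> = Fract p q" "poly q a \<noteq> 0" "b = poly p a / poly q a"
    using assms(1) unfolding has_value_at_def by blast
  obtain r s where 2: "\<phi> = Fract r s" "poly s a \<noteq> 0" "c = poly r a / poly s a"
    using assms(2) unfolding has_value_at_def by blast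
  have "p * s = r * q" using 1 2 by (metis eq_fract(1) poly_0)
  then have "poly p a * poly s a = poly r a * poly q a" by (metis poly_mult)
  then show ?thesis using 1 2 by (simp add: frac_eq_eq)
qed

definition eventual_valuation_ring ::
  "('a::field \<Rightarrow> 'g::linordered_ab_group_add) \<Rightarrow> ('o::{wellorder,no_top} \<Rightarrow> 'a)
     \<Rightarrow> 'a poly fract set" where
  "eventual_valuation_ring v z =
     {\<phi>. \<forall>\<^sub>F \<nu> in at_top. \<exists>b. has_value_at \<phi> (z \<nu>) b \<and> b \<in> valuation_ring v}"

text \<open>A valuation is determined, up to equivalence, by its valuation ring.\<close>

definition is_sequence_valuation ::
  "('a::field \<Rightarrow> 'g::linordered_ab_group_add) \<Rightarrow> ('o::{wellorder,no_top} \<Rightarrow> 'a)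
     \<Rightarrow> ('a poly fract \<Rightarrow> 'h::linordered_ab_group_add) \<Rightarrow> bool" where
  "is_sequence_valuation v z w \<longleftrightarrow>
     valuation w \<and> valuation_ring w = eventual_valuation_ring v z"

end

theory Submission
  imports Defs
begin

text \<open>For finite rank, the rank of an ordered abelian group is the number of archimedean classes
  of its nonzero elements. Since the gauges \<open>\<delta>\<^sub>\<nu>\<close> decrease strictly, the terms of the expansion of a
  polynomial around \<open>z\<^sub>\<mu>\<close> eventually have distinct values at \<open>z\<^sub>\<nu>\<close>, and one of them is minimal; hence
  \<open>v\<^sub>E K(X) = vK + \<int>\<tau>\<close>, where \<open>\<tau> = v\<^sub>E(X - z\<^sub>\<mu>)\<close> behaves like \<open>\<delta>\<^sub>\<nu>\<close> for large \<open>\<nu>\<close>. It remains to see whether some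
  integral combination \<open>m\<tau> - g\<close> with \<open>g \<in> vK\<close> forms a new archimedean class. For this one reads off
  lexicographic coordinates, choosing \<open>g\<close> and \<open>m\<close> so that the first \<open>i - 1\<close> coordinates cancel, which is
  possible because the value group of the algebraic closure is torsion over \<open>vK\<close>.\<close>

section \<open>Archimedean classes and rank\<close>

text \<open>Only the valuation ring of v_E is known, so its value group carries no coordinates;
  whatever is said about it must be read off from inequalities holding for large \<nu>. The cases
  differ as follows. Once the earlier coordinates are cancelled, the i-th coordinate of m\<tau> - g
  is m(\<delta>_i - q) for a chosen q in \<Gamma>_i. In case (a), with q = 0, its size outgrows
  every real; in case (c), with q = r', it shrinks to 0 without reaching it. Either way its class is
  met by no element of vK. In case (b) a combination with vanishing earlier coordinates has an i-th
  coordinate tending to a nonzero real, since \<Gamma>_i is divisible and omits r'. As vK has rank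
  n, each of the n positions is the leading one of some element of vK, so the class is an old one.
  Multiples m cannot be avoided: the coordinates fill the lexicographic sum only over the algebraic
  closure, whereas g must lie in vK.\<close>

definition nmul :: "nat \<Rightarrow> 'g::ab_group_add \<Rightarrow> 'g" where
  "nmul m x = (\<Sum>_<m. x)"

lemma nmul_0 [simp]: "nmul 0 x = 0"
  and nmul_Suc [simp]: "nmul (Suc m) x = x + nmul m x"
  and nmul_zero_right [simp]: "nmul m 0 = 0"
  by (simp_all add: nmul_def add.commute)

lemma nmul_add_left: "nmul (m + k) x = nmul m x + nmul k x"
  by (induction m) (simp_all add: add.assoc)

lemma nmul_add: "nmul m (x + y) = nmul m x + nmul m y"
  by (simp add: nmul_def sum.distrib)

lemma nmul_minus: "nmul m (- x) = - nmul m x"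
  by (simp add: nmul_def sum_negf)

lemma nmul_diff: "nmul m (x - y) = nmul m x - nmul m y"
  by (simp add: nmul_def sum_subtractf)

lemma nmul_mult: "nmul (m * k) x = nmul m (nmul k x)"
  by (induction m) (simp_all add: nmul_add_left)

lemma nmul_commute: "nmul m (nmul k x) = nmul k (nmul m x)"
  by (metis nmul_mult mult.commute)

lemma nmul_mono:
  fixes x y :: "'g::linordered_ab_group_add"
  shows "x \<le> y \<Longrightarrow> nmul m x \<le> nmul m y"
  unfolding nmul_def by (rule sum_mono)

lemma nmul_strict_mono:
  fixes x y :: "'g::linordered_ab_group_add"
  shows "x < y \<Longrightarrow> 0 < m \<Longrightarrow> nmul m x < nmul m y"
  unfolding nmul_def by (rule sum_strict_mono) auto

lemma nmul_mono_left:
  fixes x :: "'g::linordered_ab_group_add"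
  assumes "0 \<le> x" "m \<le> k"
  shows "nmul m x \<le> nmul k x"
  using nmul_add_left[of m "k - m" x] nmul_mono[OF assms(1), of "k - m"] assms(2) by simp

text \<open>The type class of \<open>'g\<close> does not provide \<^const>\<open>abs\<close>.\<close>

definition mag :: "'g::linordered_ab_group_add \<Rightarrow> 'g" where
  "mag x = max x (- x)"

lemma mag_cases: "0 \<le> x \<and> mag x = x \<or> x < 0 \<and> mag x = - x"
proof (cases "0 \<le> x")
  case True
  then have "- x \<le> x" by (meson neg_le_0_iff_le order_trans)
  then show ?thesis using True by (simp add: mag_def)
next
  case False
  then have "x \<le> - x" by (meson neg_0_le_iff_le not_le order_less_imp_le order_trans)
  then show ?thesis using False by (simp add: mag_def)
qed

lemma mag_nonneg [simp]: "0 \<le> mag x"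
  using mag_cases[of x] by auto

lemma mag_eq_0_iff [simp]: "mag x = 0 \<longleftrightarrow> x = 0"
  using mag_cases[of x] by auto

lemma mag_pos_eq [simp]: "0 \<le> x \<Longrightarrow> mag x = x"
  using mag_cases[of x] by auto

lemma mag_minus [simp]: "mag (- x) = mag x"
  by (simp add: mag_def max.commute)

lemma le_mag: "x \<le> mag x" "- x \<le> mag x" "- mag x \<le> x"
  using max.cobounded2[of "- x" x] by (auto simp: mag_def minus_le_iff[of "max x (- x)"])

lemma mag_le: "x \<le> c \<Longrightarrow> - x \<le> c \<Longrightarrow> mag x \<le> c"
  by (simp add: mag_def)

lemma mag_add: "mag (x + y) \<le> mag x + mag y"
proof (rule mag_le)
  show "x + y \<le> mag x + mag y" by (intro add_mono le_mag)
  have "- x + - y \<le> mag x + mag y" by (intro add_mono le_mag)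
  then show "- (x + y) \<le> mag x + mag y" by simp
qed

lemma mag_nmul: "mag (nmul m x) = nmul m (mag x)"
  using mag_cases[of x]
proof
  assume "0 \<le> x \<and> mag x = x"
  then show ?thesis using nmul_mono[of 0 x m] by simp
next
  assume *: "x < 0 \<and> mag x = - x"
  then have "0 \<le> - x" by (simp add: less_imp_le)
  then have "mag (nmul m (- x)) = nmul m (- x)" using nmul_mono[of 0 "- x" m] by simp
  then show ?thesis using * by (simp add: nmul_minus)
qed

section \<open>The archimedean preorder\<close>

definition arch_le :: "'g::linordered_ab_group_add \<Rightarrow> 'g \<Rightarrow> bool" where
  "arch_le x y \<longleftrightarrow> (\<exists>m. mag x \<le> nmul m (mag y))"

definition arch_eq :: "'g::linordered_ab_group_add \<Rightarrow> 'g \<Rightarrow> bool" where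
  "arch_eq x y \<longleftrightarrow> arch_le x y \<and> arch_le y x"

lemma arch_leI: "mag x \<le> mag y \<Longrightarrow> arch_le x y"
  unfolding arch_le_def by (intro exI[of _ 1]) simp

lemma arch_le_refl [simp]: "arch_le x x"
  by (simp add: arch_leI)

lemma arch_le_total: "arch_le x y \<or> arch_le y x"
  using linear[of "mag x" "mag y"] arch_leI by auto

lemma arch_le_trans [trans]:
  assumes "arch_le x y" "arch_le y z"
  shows "arch_le x z"
proof -
  obtain m k where "mag x \<le> nmul m (mag y)" "mag y \<le> nmul k (mag z)"
    using assms unfolding arch_le_def by blast
  then have "mag x \<le> nmul (m * k) (mag z)"
    using nmul_mono[of "mag y" "nmul k (mag z)" m] by (auto simp: nmul_mult)
  then show ?thesis unfolding arch_le_def by blast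
qed

lemma arch_le_minus [simp]: "arch_le (- x) y = arch_le x y" "arch_le x (- y) = arch_le x y"
  by (simp_all add: arch_le_def)

lemma arch_le_0_right [simp]: "arch_le x 0 \<longleftrightarrow> x = 0"
  using mag_nonneg[of x] mag_eq_0_iff[of x] by (force simp: arch_le_def dest: order_antisym)

lemma arch_le_0_left [simp]: "arch_le 0 x"
  by (simp add: arch_leI)

lemma arch_le_add:
  assumes "arch_le x z" "arch_le y z"
  shows "arch_le (x + y) z"
proof -
  obtain m k where "mag x \<le> nmul m (mag z)" "mag y \<le> nmul k (mag z)"
    using assms unfolding arch_le_def by blast
  then have "mag (x + y) \<le> nmul (m + k) (mag z)"
    using mag_add[of x y] unfolding nmul_add_left by (meson add_mono order_trans)
  then show ?thesis unfolding arch_le_def by blast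
qed

lemma arch_eq_nmul:
  assumes "0 < m"
  shows "arch_eq (nmul m x) x"
proof -
  have "mag x \<le> mag (nmul m x)"
    using nmul_mono_left[of "mag x" 1 m] assms by (simp add: mag_nmul)
  then show ?thesis
    unfolding arch_eq_def using arch_leI[of x "nmul m x"] unfolding arch_le_def
    by (auto simp: mag_nmul)
qed

lemma arch_eq_refl [simp]: "arch_eq x x"
  by (simp add: arch_eq_def)

lemma arch_eq_sym: "arch_eq x y \<Longrightarrow> arch_eq y x"
  by (simp add: arch_eq_def)

lemma arch_eq_trans [trans]: "arch_eq x y \<Longrightarrow> arch_eq y z \<Longrightarrow> arch_eq x z"
  unfolding arch_eq_def using arch_le_trans by blast

lemma arch_eq_minus [simp]: "arch_eq (- x) y = arch_eq x y" "arch_eq x (- y) = arch_eq x y"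
  by (simp_all add: arch_eq_def)

lemma arch_eq_0_right [simp]: "arch_eq x 0 \<longleftrightarrow> x = 0"
  and arch_eq_0_left [simp]: "arch_eq 0 x \<longleftrightarrow> x = 0"
  by (auto simp: arch_eq_def)

lemma arch_eq_mag [simp]: "arch_eq (mag x) y \<longleftrightarrow> arch_eq x y" "arch_eq x (mag y) \<longleftrightarrow> arch_eq x y"
  using mag_cases[of x] mag_cases[of y] by auto

text \<open>If \<open>y\<close> were not dominated by the sum, the sum would be dominated by
  \<open>y\<close>, and then so would \<open>x\<close>, the difference of the two. Archimedean
  classes thus behave like a valuation: the strictly larger summand decides.\<close>

lemma arch_eq_add:
  assumes "\<not> arch_le x y"
  shows "arch_eq (x + y) x"
proof -
  have "arch_le y x" using assms arch_le_total by blast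
  then have 1: "arch_le (x + y) x" by (simp add: arch_le_add)
  have "arch_le y (x + y)"
  proof (rule ccontr)
    assume "\<not> arch_le y (x + y)"
    then have "arch_le (x + y) y" using arch_le_total by blast
    then have "arch_le (x + y + - y) y" by (intro arch_le_add[of "x + y" y "- y"]) auto
    then show False using assms by simp
  qed
  then have "arch_le (x + y + - y) (x + y)" by (intro arch_le_add[of "x + y" "x + y" "- y"]) auto
  with 1 show ?thesis by (simp add: arch_eq_def)
qed

section \<open>Isolated subgroups as down-sets of archimedean classes\<close>

lemma is_subgroup_minus: "is_subgroup G \<Longrightarrow> x \<in> G \<Longrightarrow> - x \<in> G"
  and is_subgroup_add: "is_subgroup G \<Longrightarrow> x \<in> G \<Longrightarrow> y \<in> G \<Longrightarrow> x + y \<in> G"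
  and is_subgroup_0: "is_subgroup G \<Longrightarrow> 0 \<in> G"
  by (auto simp: is_subgroup_def)

lemma is_subgroup_diff: "is_subgroup G \<Longrightarrow> x \<in> G \<Longrightarrow> y \<in> G \<Longrightarrow> x - y \<in> G"
  by (metis is_subgroup_minus is_subgroup_add diff_conv_add_uminus)

lemma is_subgroup_nmul: "is_subgroup G \<Longrightarrow> x \<in> G \<Longrightarrow> nmul m x \<in> G"
  by (induction m) (auto simp: is_subgroup_0 is_subgroup_add)

lemma is_subgroup_mag: "is_subgroup G \<Longrightarrow> x \<in> G \<Longrightarrow> mag x \<in> G"
  using mag_cases[of x] is_subgroup_minus[of G x] by auto

text \<open>\<open>below G b\<close> is the largest isolated subgroup not containing \<open>b\<close>.\<close>

definition below :: "'g::linordered_ab_group_add set \<Rightarrow> 'g \<Rightarrow> 'g set" where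
  "below G b = {x \<in> G. \<not> arch_le b x}"

text \<open>A transversal of the nonzero archimedean classes. Positive representatives make the
  order of the group agree with the order of the classes, see
  \<open>below_subset_iff\<close>.\<close>

definition arch_basis :: "'g::linordered_ab_group_add set \<Rightarrow> 'g set \<Rightarrow> bool" where
  "arch_basis G B \<longleftrightarrow>
     B \<subseteq> {x \<in> G. 0 < x} \<and> (\<forall>x\<in>G. x \<noteq> 0 \<longrightarrow> (\<exists>b\<in>B. arch_eq x b)) \<and>
     (\<forall>b\<in>B. \<forall>c\<in>B. arch_eq b c \<longrightarrow> b = c)"

lemma below_isolated:
  assumes G: "is_subgroup G" and b: "b \<in> G" "b \<noteq> 0"
  shows "below G b \<in> isolated_subgroups G"
proof -
  \<comment> \<open>One of the two summands dominates the other and hence the sum; if the sum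
    dominated \<open>b\<close>, so would that summand.\<close>
  have add: "\<not> arch_le b (x + y)" if "\<not> arch_le b x" "\<not> arch_le b y" for x y
    using that arch_le_total[of x y] arch_le_add[of x y y] arch_le_add[of x x y] arch_le_refl
      arch_le_trans by blast
  have "is_subgroup (below G b)"
    unfolding is_subgroup_def using assms add by (auto simp: below_def is_subgroup_def)
  moreover have "below G b \<subset> G" using b arch_le_refl[of b] unfolding below_def by blast
  moreover have "y \<in> below G b" if "x \<in> below G b" "y \<in> G" "- x \<le> y" "y \<le> x" for x y
  proof -
    have "mag y \<le> mag x"
      using that le_mag(1)[of x] minus_le_iff[of x y] by (intro mag_le) auto
    then have "arch_le y x" by (rule arch_leI)
    then show ?thesis using that arch_le_trans unfolding below_def by blast
  qed
  ultimately show ?thesis unfolding isolated_subgroups_def by blast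
qed

text \<open>Closure under multiples and convexity together make an isolated subgroup a down-set for
  \<open>arch_le\<close>.\<close>

lemma isolated_arch_le:
  assumes D: "D \<in> isolated_subgroups G" and x: "x \<in> D" and y: "y \<in> G" "arch_le y x"
  shows "y \<in> D"
proof -
  obtain m where m: "mag y \<le> nmul m (mag x)" using y(2) unfolding arch_le_def by blast
  have sub: "is_subgroup D" using D unfolding isolated_subgroups_def by blast
  have "nmul m (mag x) \<in> D" using sub x by (intro is_subgroup_nmul is_subgroup_mag)
  moreover have "- nmul m (mag x) \<le> y" "y \<le> nmul m (mag x)"
    using m le_mag[of y] by (meson neg_le_iff_le order_trans)+
  ultimately show ?thesis using D y(1) unfolding isolated_subgroups_def by blast
qed

text \<open>If \<open>c < b\<close>, the two classes being distinct, \<open>c\<close> itself lies in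
  \<open>below G b\<close> but not in \<open>below G c\<close>.\<close>

lemma below_subset_iff:
  assumes "arch_basis G B" "b \<in> B" "c \<in> B"
  shows "below G b \<subseteq> below G c \<longleftrightarrow> b \<le> c"
proof
  have pos: "0 < b" "0 < c" "b \<in> G" "c \<in> G" using assms unfolding arch_basis_def by blast+
  { assume sub: "below G b \<subseteq> below G c"
    show "b \<le> c"
    proof (rule ccontr)
      assume "\<not> b \<le> c"
      then have "arch_le c b" "b \<noteq> c" using pos by (auto intro: arch_leI)
      then have "\<not> arch_le b c"
        using assms unfolding arch_basis_def arch_eq_def by blast
      then have "c \<in> below G b" using pos by (simp add: below_def)
      then show False using sub by (auto simp: below_def)
    qed }
  assume "b \<le> c"
  then have "arch_le b c" using pos by (intro arch_leI) auto
  then show "below G b \<subseteq> below G c" unfolding below_def using arch_le_trans by blast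
qed

lemma inj_on_below:
  assumes "arch_basis G B"
  shows "inj_on (below G) B"
  by (rule inj_onI) (metis below_subset_iff[OF assms] order_eq_iff)

lemma bij_betw_below:
  assumes G: "is_subgroup G" and B: "arch_basis G B" "finite B"
  shows "bij_betw (below G) B (isolated_subgroups G)"
  unfolding bij_betw_def
proof
  show "inj_on (below G) B" using B by (intro inj_on_below)
  have pos: "0 < b" "b \<in> G" if "b \<in> B" for b using that B unfolding arch_basis_def by blast+
  show "below G ` B = isolated_subgroups G"
  proof
    show "below G ` B \<subseteq> isolated_subgroups G" using below_isolated[OF G] pos by fastforce
    show "isolated_subgroups G \<subseteq> below G ` B"
    proof
      fix D assume D: "D \<in> isolated_subgroups G"
      have sub: "is_subgroup D" "D \<subset> G" using D unfolding isolated_subgroups_def by blast+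
      obtain x where x: "x \<in> G" "x \<notin> D" using sub by blast
      then have "x \<noteq> 0" using sub(1) is_subgroup_0 by blast
      then obtain b0 where b0: "b0 \<in> B" "arch_eq x b0"
        using B x unfolding arch_basis_def by blast
      then have "b0 \<in> B - D" using isolated_arch_le[OF D _ x(1)] x(2) unfolding arch_eq_def by blast
      then have ne: "B - D \<noteq> {}" "finite (B - D)" using B by auto
      \<comment> \<open>Finiteness provides a lowest class missed by \<open>D\<close>; as
        \<open>D\<close> is a down-set, it consists of exactly what lies strictly below that
        class.\<close>
      define b where "b = Min (B - D)"
      have b: "b \<in> B" "b \<notin> D" using Min_in[OF ne(2,1)] unfolding b_def by auto
      have least: "b \<le> c" if "c \<in> B" "c \<notin> D" for c
        using that ne Min_le unfolding b_def by blast
      have "D = below G b"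
      proof (intro equalityI subsetI)
        fix y assume "y \<in> D"
        then show "y \<in> below G b"
          using b sub(2) pos isolated_arch_le[OF D, of y b] unfolding below_def by blast
      next
        fix y assume y: "y \<in> below G b"
        show "y \<in> D"
        proof (rule ccontr)
          assume "y \<notin> D"
          then have "y \<noteq> 0" using sub(1) is_subgroup_0 by blast
          then obtain c where c: "c \<in> B" "arch_eq y c"
            using B y unfolding arch_basis_def below_def by blast
          then have "c \<notin> D"
            using isolated_arch_le[OF D, of c y] y \<open>y \<notin> D\<close> unfolding arch_eq_def below_def by blast
          then have "b \<le> c" using least c by blast
          then have "arch_le b c" using pos[OF b(1)] pos[OF c(1)] by (intro arch_leI) auto
          then have "arch_le b y" using c arch_le_trans unfolding arch_eq_def by blast
          then show False using y unfolding below_def by blast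
        qed
      qed
      then show "D \<in> below G ` B" using b by blast
    qed
  qed
qed

text \<open>The representative is chosen from the predicate \<open>P x\<close> alone. Equivalent
  elements have equal predicates, so each class receives a single representative.\<close>

lemma ex_arch_basis:
  assumes G: "is_subgroup G"
  shows "\<exists>B. arch_basis G B"
proof -
  define P where "P x y \<longleftrightarrow> y \<in> G \<and> 0 < y \<and> arch_eq x y" for x y
  define f where "f x = (SOME y. P x y)" for x
  have f: "P x (f x)" if "x \<in> G" "x \<noteq> 0" for x
  proof -
    have "P x (mag x)"
      using that G is_subgroup_mag mag_nonneg[of x] by (auto simp: P_def less_le)
    then show ?thesis unfolding f_def by (rule someI)
  qed
  have eq: "f x = f y" if "arch_eq x y" for x y
  proof -
    have "P x = P y" using that arch_eq_trans arch_eq_sym unfolding P_def by blast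
    then show ?thesis by (simp add: f_def)
  qed
  have "arch_basis G (f ` (G - {0}))"
    unfolding arch_basis_def
  proof (intro conjI ballI impI)
    show "f ` (G - {0}) \<subseteq> {x \<in> G. 0 < x}" using f unfolding P_def by blast
    show "\<exists>b\<in>f ` (G - {0}). arch_eq x b" if "x \<in> G" "x \<noteq> 0" for x
      using that f unfolding P_def by blast
    fix b c assume "b \<in> f ` (G - {0})" "c \<in> f ` (G - {0})" and bc: "arch_eq b c"
    then obtain x y where xy: "x \<in> G" "x \<noteq> 0" "b = f x" "y \<in> G" "y \<noteq> 0" "c = f y" by blast
    then have "arch_eq x b" "arch_eq y c" using f unfolding P_def by blast+
    then have "arch_eq x y" by (meson bc arch_eq_trans arch_eq_sym)
    then show "b = c" using eq xy by simp
  qed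
  then show ?thesis by blast
qed

lemma has_rank_iff_arch_basis:
  assumes G: "is_subgroup G"
  shows "has_rank G n \<longleftrightarrow> (\<exists>B. arch_basis G B \<and> finite B \<and> card B = n)"
proof
  assume "has_rank G n"
  then obtain f where f: "bij_betw f {..<n} (isolated_subgroups G)"
    unfolding has_rank_def by blast
  then have fin: "finite (isolated_subgroups G)" and card: "card (isolated_subgroups G) = n"
    using bij_betw_finite bij_betw_same_card by (blast, fastforce)
  obtain B where B: "arch_basis G B" using ex_arch_basis[OF G] by blast
  \<comment> \<open>\<open>bij_betw_below\<close> presupposes a finite basis, so finiteness is
    obtained beforehand from injectivity into the finite set of isolated subgroups.\<close>
  have "below G ` B \<subseteq> isolated_subgroups G"
    using B below_isolated[OF G] unfolding arch_basis_def by force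
  then have "finite B" using inj_on_below[OF B] fin inj_on_finite by blast
  then show "\<exists>B. arch_basis G B \<and> finite B \<and> card B = n"
    using B bij_betw_same_card[OF bij_betw_below[OF G B]] card by metis
next
  assume "\<exists>B. arch_basis G B \<and> finite B \<and> card B = n"
  then obtain B where B: "arch_basis G B" "finite B" "card B = n" by blast
  let ?l = "sorted_list_of_set B"
  have l: "sorted_wrt (<) ?l" "set ?l = B" "length ?l = n" "distinct ?l"
    using B by auto
  have bij: "bij_betw ((!) ?l) {..<n} B"
    using bij_betw_nth[OF l(4)] l by auto
  have "below G (?l ! i) \<subseteq> below G (?l ! j) \<longleftrightarrow> i \<le> j" if "i < n" "j < n" for i j
  proof -
    have mem: "?l ! i \<in> B" "?l ! j \<in> B" using that l by (metis nth_mem)+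
    have "?l ! i \<le> ?l ! j \<longleftrightarrow> i \<le> j"
      using that l sorted_wrt_nth_less[OF l(1)] 
      by (metis linorder_not_le nat_less_le order_less_imp_le order_refl)
    then show ?thesis using below_subset_iff[OF B(1) mem] by simp
  qed
  then show "has_rank G n"
    unfolding has_rank_def
    using bij_betw_trans[OF bij bij_betw_below[OF G B(1,2)]]
    by (intro exI[of _ "below G \<circ> (!) ?l"]) simp
qed

text \<open>A basis of \<open>H\<close> carried over by \<open>\<phi>\<close>, joined with
  \<open>A\<close>, is a basis of \<open>G\<close>. The map enters only through its effect on
  positivity and on archimedean classes. \<open>A\<close> will be empty or a singleton.\<close>

lemma has_rank_embedding:
  assumes H: "is_subgroup H" and G: "is_subgroup G"
    and \<phi>: "\<And>h. h \<in> H \<Longrightarrow> \<phi> h \<in> G" "\<And>h. h \<in> H \<Longrightarrow> 0 < h \<Longrightarrow> 0 < \<phi> h"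
    and arch: "\<And>h k. h \<in> H \<Longrightarrow> k \<in> H \<Longrightarrow> arch_eq (\<phi> h) (\<phi> k) \<longleftrightarrow> arch_eq h k"
    and A: "finite A" "A \<subseteq> {x \<in> G. 0 < x}" "\<And>a b. a \<in> A \<Longrightarrow> b \<in> A \<Longrightarrow> arch_eq a b \<Longrightarrow> a = b"
    and disjoint: "\<And>a h. a \<in> A \<Longrightarrow> h \<in> H \<Longrightarrow> \<not> arch_eq a (\<phi> h)"
    and cover: "\<And>x. x \<in> G \<Longrightarrow> x \<noteq> 0 \<Longrightarrow>
      (\<exists>h\<in>H. h \<noteq> 0 \<and> arch_eq x (\<phi> h)) \<or> (\<exists>a\<in>A. arch_eq x a)"
    and rank: "has_rank H n"
  shows "has_rank G (n + card A)"
proof -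
  obtain B where B: "arch_basis H B" "finite B" "card B = n"
    using rank has_rank_iff_arch_basis[OF H] by blast
  have BH: "b \<in> H" "0 < b" if "b \<in> B" for b
    using B(1) that unfolding arch_basis_def by blast+
  have inj: "b = c" if "b \<in> B" "c \<in> B" "arch_eq (\<phi> b) (\<phi> c)" for b c
    using B(1) that BH arch unfolding arch_basis_def by blast
  have "inj_on \<phi> B" by (rule inj_onI) (metis inj arch_eq_refl)
  moreover have "\<phi> ` B \<inter> A = {}"
    using disjoint BH by (auto simp: disjoint_iff) (metis arch_eq_refl)
  ultimately have card: "card (\<phi> ` B \<union> A) = n + card A"
    using B A(1) by (simp add: card_Un_disjoint card_image)
  have "arch_basis G (\<phi> ` B \<union> A)"
    unfolding arch_basis_def
  proof (intro conjI ballI impI)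
    show "\<phi> ` B \<union> A \<subseteq> {x \<in> G. 0 < x}" using A(2) \<phi> BH by auto
    show "\<exists>b\<in>\<phi> ` B \<union> A. arch_eq x b" if x: "x \<in> G" "x \<noteq> 0" for x
      using cover[OF x]
    proof
      assume "\<exists>h\<in>H. h \<noteq> 0 \<and> arch_eq x (\<phi> h)"
      then obtain h where h: "h \<in> H" "h \<noteq> 0" "arch_eq x (\<phi> h)" by blast
      then obtain b where b: "b \<in> B" "arch_eq h b" using B(1) unfolding arch_basis_def by blast
      then have "arch_eq (\<phi> h) (\<phi> b)" using arch h BH by blast
      then have "arch_eq x (\<phi> b)" using h(3) arch_eq_trans by blast
      then show ?thesis using b by blast
    qed blast
    fix b c assume bc: "b \<in> \<phi> ` B \<union> A" "c \<in> \<phi> ` B \<union> A" "arch_eq b c"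
    then consider "b \<in> \<phi> ` B" "c \<in> \<phi> ` B" | "b \<in> A" "c \<in> A"
      using disjoint BH(1) arch_eq_sym by blast
    then show "b = c"
    proof cases
      case 1
      then show ?thesis using inj bc(3) by auto
    next
      case 2
      then show ?thesis using A(3) bc(3) by blast
    qed
  qed
  then show ?thesis using has_rank_iff_arch_basis[OF G] card B(2) A(1) by blast
qed

section \<open>The value group of the sequence valuation\<close>

lemma valuation_mult: "valuation v \<Longrightarrow> x \<noteq> 0 \<Longrightarrow> y \<noteq> 0 \<Longrightarrow> v (x * y) = v x + v y"
  by (auto simp: valuation_def)

lemma valuation_one: "valuation v \<Longrightarrow> v 1 = 0"
  using valuation_mult[of v 1 1] by simp

lemma valuation_inverse: "valuation v \<Longrightarrow> x \<noteq> 0 \<Longrightarrow> v (inverse x) = - v x"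
  using valuation_mult[of v x "inverse x"] valuation_one[of v]
  by (simp add: eq_neg_iff_add_eq_0 add.commute)

lemma valuation_power: "valuation v \<Longrightarrow> x \<noteq> 0 \<Longrightarrow> v (x ^ k) = nmul k (v x)"
  by (induction k) (auto simp: valuation_one valuation_mult)

lemma value_group_I: "x \<noteq> 0 \<Longrightarrow> v x \<in> value_group v"
  by (simp add: value_group_def)

lemma value_group_E: "h \<in> value_group v \<Longrightarrow> (\<And>x. x \<noteq> 0 \<Longrightarrow> v x = h \<Longrightarrow> P) \<Longrightarrow> P"
  by (auto simp: value_group_def)

lemma is_subgroup_value_group:
  assumes v: "valuation v"
  shows "is_subgroup (value_group v)"
  unfolding is_subgroup_def
proof (intro conjI ballI)
  show "0 \<in> value_group v" using value_group_I[of 1 v] valuation_one[OF v] by simp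
  fix a assume a: "a \<in> value_group v"
  then obtain x where x: "x \<noteq> 0" "v x = a" by (rule value_group_E)
  show "- a \<in> value_group v"
    using value_group_I[of "inverse x" v] valuation_inverse[OF v, of x] x by simp
  fix b assume "b \<in> value_group v"
  then obtain y where y: "y \<noteq> 0" "v y = b" by (rule value_group_E)
  show "a + b \<in> value_group v"
    using value_group_I[of "x * y" v] valuation_mult[OF v, of x y] x y by simp
qed

lemma valuation_sum_nonzero:
  assumes v: "valuation v" and "x \<noteq> 0" "y \<noteq> 0" "v x \<noteq> v y"
  shows "x + y \<noteq> 0"
  using valuation_minus[OF v] assms by (metis eq_neg_iff_add_eq_0)

lemma gauge_strict_antimono:
  assumes v: "valuation v" and z: "pseudo_divergent v z" and "index_one \<le> \<mu>" "\<mu> < \<nu>"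
  shows "gauge v z \<nu> < gauge v z \<mu>"
proof -
  obtain \<kappa> where \<kappa>: "\<kappa> < \<mu>" using assms(3) index_one_le_iff by blast
  have nz: "z \<mu> - z \<kappa> \<noteq> 0" "z \<nu> - z \<mu> \<noteq> 0"
    using z \<kappa> assms(4) unfolding pseudo_divergent_def by auto
  have "v (z \<mu> - z \<nu>) < v (z \<kappa> - z \<mu>)"
    using z \<kappa> assms(4) unfolding pseudo_divergent_def by blast
  then show ?thesis
    using gauge_eq[OF v z \<kappa>] gauge_eq[OF v z assms(4)] valuation_minus[OF v] nz
    by (metis minus_diff_eq)
qed

lemma gauge_in_value_group:
  assumes v: "valuation v" and z: "pseudo_divergent v z" and "index_one \<le> \<nu>"
  shows "gauge v z \<nu> \<in> value_group v"
proof -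
  obtain \<mu> where \<mu>: "\<mu> < \<nu>" using assms(3) index_one_le_iff by blast
  then have "z \<nu> - z \<mu> \<noteq> 0" using z unfolding pseudo_divergent_def by auto
  then show ?thesis using gauge_eq[OF v z \<mu>] value_group_I by metis
qed

lemma eventually_at_top_index_one: "\<forall>\<^sub>F \<nu>::'o::{wellorder,no_top} in at_top. index_one \<le> \<nu>"
  by (rule eventually_ge_at_top)

lemma has_value_at_mult:
  assumes "has_value_at f a b" "has_value_at g a c"
  shows "has_value_at (f * g) a (b * c)"
proof -
  obtain p q where 1: "f = Fract p q" "poly q a \<noteq> 0" "b = poly p a / poly q a"
    using assms(1) unfolding has_value_at_def by blast
  obtain r s where 2: "g = Fract r s" "poly s a \<noteq> 0" "c = poly r a / poly s a"
    using assms(2) unfolding has_value_at_def by blast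
  show ?thesis unfolding has_value_at_def
    by (rule exI[of _ "p * r"], rule exI[of _ "q * s"]) (use 1 2 in simp)
qed

lemma has_value_at_inverse:
  assumes "has_value_at f a b" "b \<noteq> 0"
  shows "has_value_at (inverse f) a (inverse b)"
proof -
  obtain p q where 1: "f = Fract p q" "poly q a \<noteq> 0" "b = poly p a / poly q a"
    using assms(1) unfolding has_value_at_def by blast
  show ?thesis unfolding has_value_at_def
    by (rule exI[of _ q], rule exI[of _ p]) (use 1 assms(2) in simp)
qed

section \<open>Germs along the sequence\<close>

locale sequence_valuation =
  fixes v :: "'a::field \<Rightarrow> 'g::linordered_ab_group_add"
    and z :: "'o::{wellorder,no_top} \<Rightarrow> 'a"
    and w :: "'a poly fract \<Rightarrow> 'h::linordered_ab_group_add"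
  assumes v: "valuation v"
    and z: "pseudo_divergent v z"
    and w: "is_sequence_valuation v z w"
begin

text \<open>Only the germ of \<open>s\<close> at the top of the index type matters.\<close>

definition germ_of :: "'a poly fract \<Rightarrow> ('o \<Rightarrow> 'g) \<Rightarrow> bool" where
  "germ_of f s \<longleftrightarrow> (\<forall>\<^sub>F \<nu> in at_top. \<exists>b. has_value_at f (z \<nu>) b \<and> b \<noteq> 0 \<and> v b = s \<nu>)"

lemma w_valuation: "valuation w"
  using w by (simp add: is_sequence_valuation_def)

lemma germ_of_cong:
  assumes "germ_of f s" "\<forall>\<^sub>F \<nu> in at_top. s \<nu> = t \<nu>"
  shows "germ_of f t"
  using assms unfolding germ_of_def by eventually_elim auto

lemma germ_of_mult:
  assumes "germ_of f s" "germ_of g t"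
  shows "germ_of (f * g) (\<lambda>\<nu>. s \<nu> + t \<nu>)"
  using assms unfolding germ_of_def
proof eventually_elim
  case (elim \<nu>)
  then obtain b c where "has_value_at f (z \<nu>) b" "b \<noteq> 0" "v b = s \<nu>"
    "has_value_at g (z \<nu>) c" "c \<noteq> 0" "v c = t \<nu>" by blast
  then show ?case
    using has_value_at_mult valuation_mult[OF v] by (intro exI[of _ "b * c"]) auto
qed

lemma germ_of_inverse:
  assumes "germ_of f s"
  shows "germ_of (inverse f) (\<lambda>\<nu>. - s \<nu>)"
  using assms unfolding germ_of_def
proof eventually_elim
  case (elim \<nu>)
  then obtain b where "has_value_at f (z \<nu>) b" "b \<noteq> 0" "v b = s \<nu>" by blast
  then show ?case
    using has_value_at_inverse valuation_inverse[OF v] by (intro exI[of _ "inverse b"]) auto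
qed

lemma germ_of_poly:
  assumes "\<forall>\<^sub>F \<nu> in at_top. poly p (z \<nu>) \<noteq> 0 \<and> v (poly p (z \<nu>)) = s \<nu>"
  shows "germ_of (Fract p 1) s"
  unfolding germ_of_def using assms
proof eventually_elim
  case (elim \<nu>)
  have "has_value_at (Fract p 1) (z \<nu>) (poly p (z \<nu>))"
    unfolding has_value_at_def by (rule exI[of _ p], rule exI[of _ 1]) simp
  then show ?case using elim by blast
qed

text \<open>The valuation ring reveals only the sign of a value. This is the sole bridge from the
  sequence to \<open>w\<close>; later comparisons reduce to the sign of a difference.\<close>

lemma nonneg_iff_germ:
  assumes f: "f \<noteq> 0" "germ_of f s"
  shows "0 \<le> w f \<longleftrightarrow> (\<forall>\<^sub>F \<nu> in at_top. 0 \<le> s \<nu>)"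
proof -
  have "0 \<le> w f \<longleftrightarrow> f \<in> valuation_ring w" using f by (simp add: valuation_ring_def)
  also have "\<dots> \<longleftrightarrow> (\<forall>\<^sub>F \<nu> in at_top. \<exists>b. has_value_at f (z \<nu>) b \<and> b \<in> valuation_ring v)"
    using w by (simp add: is_sequence_valuation_def eventual_valuation_ring_def)
  also have "\<dots> \<longleftrightarrow> (\<forall>\<^sub>F \<nu> in at_top. 0 \<le> s \<nu>)"
  proof (rule eventually_cong[OF f(2)[unfolded germ_of_def]])
    fix \<nu> assume "\<exists>b. has_value_at f (z \<nu>) b \<and> b \<noteq> 0 \<and> v b = s \<nu>"
    then obtain b where b: "has_value_at f (z \<nu>) b" "b \<noteq> 0" "v b = s \<nu>" by blast
    have "(\<exists>b. has_value_at f (z \<nu>) b \<and> b \<in> valuation_ring v) \<longleftrightarrow> b \<in> valuation_ring v"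
      using b(1) has_value_at_unique by blast
    then show "(\<exists>b. has_value_at f (z \<nu>) b \<and> b \<in> valuation_ring v) \<longleftrightarrow> 0 \<le> s \<nu>"
      using b by (simp add: valuation_ring_def)
  qed
  finally show ?thesis .
qed

text \<open>Stands in for coordinates on the value group of \<open>w\<close>: an element is handled
  through a function describing it near the top. A relation is used because the function is
  determined only up to eventual equality.\<close>

definition has_germ :: "'h \<Rightarrow> ('o \<Rightarrow> 'g) \<Rightarrow> bool" where
  "has_germ x s \<longleftrightarrow> (\<exists>f. f \<noteq> 0 \<and> w f = x \<and> germ_of f s)"

lemma has_germ_in_value_group: "has_germ x s \<Longrightarrow> x \<in> value_group w"
  by (auto simp: has_germ_def value_group_def)

lemma has_germ_eventually:
  assumes "has_germ x s"
  shows "\<forall>\<^sub>F \<nu> in at_top. s \<nu> \<in> value_group v"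
proof -
  obtain f where "germ_of f s" using assms unfolding has_germ_def by blast
  then show ?thesis
    unfolding germ_of_def by eventually_elim (metis value_group_I)
qed

lemma has_germ_cong:
  "has_germ x s \<Longrightarrow> \<forall>\<^sub>F \<nu> in at_top. s \<nu> = t \<nu> \<Longrightarrow> has_germ x t"
  unfolding has_germ_def using germ_of_cong by blast

lemma has_germ_add:
  assumes "has_germ x s" "has_germ y t"
  shows "has_germ (x + y) (\<lambda>\<nu>. s \<nu> + t \<nu>)"
proof -
  obtain f g where "f \<noteq> 0" "w f = x" "germ_of f s" "g \<noteq> 0" "w g = y" "germ_of g t"
    using assms unfolding has_germ_def by blast
  then show ?thesis unfolding has_germ_def
    using germ_of_mult valuation_mult[OF w_valuation] by (intro exI[of _ "f * g"]) auto
qed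

lemma has_germ_minus:
  assumes "has_germ x s"
  shows "has_germ (- x) (\<lambda>\<nu>. - s \<nu>)"
proof -
  obtain f where "f \<noteq> 0" "w f = x" "germ_of f s"
    using assms unfolding has_germ_def by blast
  then show ?thesis unfolding has_germ_def
    using germ_of_inverse valuation_inverse[OF w_valuation] by (intro exI[of _ "inverse f"]) auto
qed

lemma has_germ_diff:
  assumes "has_germ x s" "has_germ y t"
  shows "has_germ (x - y) (\<lambda>\<nu>. s \<nu> - t \<nu>)"
  using has_germ_add[OF assms(1) has_germ_minus[OF assms(2)]] by simp

lemma has_germ_const:
  assumes "h \<in> value_group v"
  shows "\<exists>x. has_germ x (\<lambda>_. h)"
proof -
  obtain c where c: "c \<noteq> 0" "v c = h" using assms by (rule value_group_E)
  have "germ_of (Fract [:c:] 1) (\<lambda>_. h)" using c by (intro germ_of_poly) simp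
  moreover have "Fract [:c:] 1 \<noteq> 0" using c by (simp add: Zero_fract_def eq_fract)
  ultimately show ?thesis unfolding has_germ_def by blast
qed

lemma has_germ_nmul:
  assumes "has_germ x s"
  shows "has_germ (nmul m x) (\<lambda>\<nu>. nmul m (s \<nu>))"
proof (induction m)
  case 0
  have "germ_of (Fract 1 1) (\<lambda>_. 0)" using valuation_one[OF v] by (intro germ_of_poly) simp
  then have "germ_of 1 (\<lambda>_. 0)" by (simp add: One_fract_def)
  then show ?case
    using valuation_one[OF w_valuation] unfolding has_germ_def by (intro exI[of _ 1]) simp
next
  case (Suc m)
  then show ?case using has_germ_add[OF assms] by simp
qed

lemma has_germ_le_iff:
  assumes "has_germ x s" "has_germ y t"
  shows "x \<le> y \<longleftrightarrow> (\<forall>\<^sub>F \<nu> in at_top. s \<nu> \<le> t \<nu>)"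
proof -
  obtain f where "f \<noteq> 0" "w f = y - x" "germ_of f (\<lambda>\<nu>. t \<nu> - s \<nu>)"
    using has_germ_diff[OF assms(2,1)] unfolding has_germ_def by blast
  then show ?thesis using nonneg_iff_germ by fastforce
qed

lemma has_germ_unique: "has_germ x s \<Longrightarrow> has_germ y s \<Longrightarrow> x = y"
  using has_germ_le_iff[of x s y s] has_germ_le_iff[of y s x s] by (intro order_antisym) simp_all

lemma has_germ_zero_iff: "has_germ x (\<lambda>_. 0) \<longleftrightarrow> x = 0"
proof
  obtain y where "has_germ y (\<lambda>_. 0)" using has_germ_const is_subgroup_value_group[OF v] is_subgroup_0 by blast
  then have *: "has_germ 0 (\<lambda>_. 0)" using has_germ_nmul[of y "\<lambda>_. 0" 0] by simp
  show "has_germ x (\<lambda>_. 0) \<Longrightarrow> x = 0" using * has_germ_unique by blast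
  show "x = 0 \<Longrightarrow> has_germ x (\<lambda>_. 0)" using * by simp
qed

lemma has_germ_mag:
  assumes "has_germ x s"
  shows "has_germ (mag x) (\<lambda>\<nu>. mag (s \<nu>))"
  using mag_cases[of x]
proof
  assume x: "0 \<le> x \<and> mag x = x"
  then have "\<forall>\<^sub>F \<nu> in at_top. 0 \<le> s \<nu>"
    using has_germ_le_iff[of 0 "\<lambda>_. 0" x s] has_germ_zero_iff assms by simp
  then have "\<forall>\<^sub>F \<nu> in at_top. s \<nu> = mag (s \<nu>)" by eventually_elim simp
  then show ?thesis using x assms has_germ_cong by auto
next
  assume x: "x < 0 \<and> mag x = - x"
  then have "\<forall>\<^sub>F \<nu> in at_top. s \<nu> \<le> 0"
    using has_germ_le_iff[of x s 0 "\<lambda>_. 0"] has_germ_zero_iff assms by (simp add: less_imp_le)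
  then have "\<forall>\<^sub>F \<nu> in at_top. - s \<nu> = mag (s \<nu>)"
    by eventually_elim (metis mag_minus mag_pos_eq neg_0_le_iff_le)
  then show ?thesis using x has_germ_minus[OF assms] has_germ_cong by auto
qed

lemma arch_le_iff_germ:
  assumes "has_germ x s" "has_germ y t"
  shows "arch_le x y \<longleftrightarrow> (\<exists>m. \<forall>\<^sub>F \<nu> in at_top. mag (s \<nu>) \<le> nmul m (mag (t \<nu>)))"
  unfolding arch_le_def
  using has_germ_le_iff[OF has_germ_mag[OF assms(1)] has_germ_nmul[OF has_germ_mag[OF assms(2)]]]
  by simp

text \<open>Horner's scheme: \<open>pCons c q\<close> adds \<open>c\<close> to x times the value of
  \<open>q\<close>. The second term carries a positive multiple of the gauge, so its value strictly
  decreases and can agree with \<open>v c\<close> at most once.\<close>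

lemma poly_eventual_value:
  assumes "p \<noteq> 0"
  shows "\<exists>c k. c \<noteq> 0 \<and> (\<forall>\<^sub>F \<nu> in at_top. poly p (z \<nu> - z \<mu>) \<noteq> 0 \<and>
           v (poly p (z \<nu> - z \<mu>)) = v c + nmul k (gauge v z \<nu>))"
  using assms
proof (induction p)
  case (pCons c q)
  show ?case
  proof (cases "q = 0")
    case True
    then show ?thesis using pCons.hyps by (intro exI[of _ c] exI[of _ 0]) simp
  next
    case False
    then obtain d k where d: "d \<noteq> 0" and ev: "\<forall>\<^sub>F \<nu> in at_top. poly q (z \<nu> - z \<mu>) \<noteq> 0 \<and>
           v (poly q (z \<nu> - z \<mu>)) = v d + nmul k (gauge v z \<nu>)"
      using pCons.IH by blast
    define s where "s \<nu> = v d + nmul (Suc k) (gauge v z \<nu>)" for \<nu>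
    have ev': "\<forall>\<^sub>F \<nu> in at_top. (z \<nu> - z \<mu>) * poly q (z \<nu> - z \<mu>) \<noteq> 0 \<and>
           v ((z \<nu> - z \<mu>) * poly q (z \<nu> - z \<mu>)) = s \<nu>"
      using ev eventually_gt_at_top[of \<mu>]
    proof eventually_elim
      case (elim \<nu>)
      then have "z \<nu> - z \<mu> \<noteq> 0" using z unfolding pseudo_divergent_def by auto
      then show ?case
        using elim gauge_eq[OF v z, of \<mu> \<nu>] valuation_mult[OF v] by (simp add: s_def add_ac)
    qed
    \<comment> \<open>The case \<open>c = 0\<close> stands apart because \<open>v 0\<close> is
      unspecified.\<close>
    consider "c = 0" | "c \<noteq> 0" "\<forall>\<^sub>F \<nu> in at_top. s \<nu> < v c" | "c \<noteq> 0" "\<forall>\<^sub>F \<nu> in at_top. v c < s \<nu>"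
    \<comment> \<open>Either the strictly decreasing \<open>s\<close> reaches \<open>v c\<close>
      somewhere and is below it ever after, or it stays above throughout.\<close>
    proof (cases "\<exists>\<kappa>\<ge>index_one. s \<kappa> \<le> v c")
      case True
      then obtain \<kappa> where \<kappa>: "index_one \<le> \<kappa>" "s \<kappa> \<le> v c" by blast
      have "\<forall>\<^sub>F \<nu> in at_top. s \<nu> < v c"
        using eventually_gt_at_top[of \<kappa>]
      proof eventually_elim
        case (elim \<nu>)
        have "s \<nu> < s \<kappa>"
          unfolding s_def using gauge_strict_antimono[OF v z \<kappa>(1) elim]
          by (intro add_strict_left_mono nmul_strict_mono) auto
        then show ?case using \<kappa>(2) by simp
      qed
      then show ?thesis using that by blast
    next
      case False
      then have "v c < s \<nu>" if "index_one \<le> \<nu>" for \<nu> using that not_le by blast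
      then have "\<forall>\<^sub>F \<nu> in at_top. v c < s \<nu>"
        using eventually_at_top_index_one by (rule eventually_mono[rotated])
      then show ?thesis using that by blast
    qed
    then show ?thesis
    proof cases
      case 1
      then show ?thesis using ev' d
        by (intro exI[of _ d] exI[of _ "Suc k"]) (simp add: s_def)
    next
      case 2
      have "\<forall>\<^sub>F \<nu> in at_top. poly (pCons c q) (z \<nu> - z \<mu>) \<noteq> 0 \<and>
           v (poly (pCons c q) (z \<nu> - z \<mu>)) = s \<nu>"
        using ev' 2(2)
      proof eventually_elim
        case (elim \<nu>)
        then show ?case
          using valuation_add_eq[OF v 2(1), of "(z \<nu> - z \<mu>) * poly q (z \<nu> - z \<mu>)"]
            valuation_sum_nonzero[OF v 2(1), of "(z \<nu> - z \<mu>) * poly q (z \<nu> - z \<mu>)"] by auto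
      qed
      then show ?thesis using d by (intro exI[of _ d] exI[of _ "Suc k"]) (simp add: s_def)
    next
      case 3
      have "\<forall>\<^sub>F \<nu> in at_top. poly (pCons c q) (z \<nu> - z \<mu>) \<noteq> 0 \<and>
           v (poly (pCons c q) (z \<nu> - z \<mu>)) = v c"
        using ev' 3(2)
      proof eventually_elim
        case (elim \<nu>)
        then show ?case
          using valuation_add_eq[OF v _ 3(1), of "(z \<nu> - z \<mu>) * poly q (z \<nu> - z \<mu>)"]
            valuation_sum_nonzero[OF v 3(1), of "(z \<nu> - z \<mu>) * poly q (z \<nu> - z \<mu>)"]
          by (auto simp: add.commute)
      qed
      then show ?thesis using 3(1) by (intro exI[of _ c] exI[of _ 0]) simp
    qed
  qed
qed simp

lemma germ_of_Fract_1:
  assumes "p \<noteq> 0"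
  shows "\<exists>h\<in>value_group v. \<exists>k. germ_of (Fract p 1) (\<lambda>\<nu>. h + nmul k (gauge v z \<nu>))"
proof -
  \<comment> \<open>Any base point serves: shifting the variable makes the argument z\<nu> - z\<mu>,
    whose value is the gauge as soon as \<nu> exceeds \<mu>.\<close>
  fix \<mu> :: 'o
  define q where "q = pcompose p [:z \<mu>, 1:]"
  have q: "poly q (x - z \<mu>) = poly p x" for x by (simp add: q_def poly_pcompose)
  have "q \<noteq> 0" using assms by (simp add: q_def pcompose_eq_0_iff)
  then obtain c k where c: "c \<noteq> 0" and "\<forall>\<^sub>F \<nu> in at_top. poly q (z \<nu> - z \<mu>) \<noteq> 0 \<and>
           v (poly q (z \<nu> - z \<mu>)) = v c + nmul k (gauge v z \<nu>)"
    using poly_eventual_value by blast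
  then have "germ_of (Fract p 1) (\<lambda>\<nu>. v c + nmul k (gauge v z \<nu>))"
    unfolding q by (intro germ_of_poly)
  then show ?thesis using value_group_I[OF c] by blast
qed

text \<open>A quotient yields the exponent \<open>k - k'\<close>, which may be negative. Since
  \<open>nmul\<close> takes natural numbers, the sign is moved onto \<open>x\<close>; archimedean
  classes do not notice.\<close>

lemma value_group_germ:
  assumes "x \<in> value_group w"
  shows "\<exists>h\<in>value_group v. \<exists>k. has_germ x (\<lambda>\<nu>. h + nmul k (gauge v z \<nu>)) \<or>
           has_germ (- x) (\<lambda>\<nu>. h + nmul k (gauge v z \<nu>))"
proof -
  obtain f where f: "f \<noteq> 0" "w f = x" using assms by (rule value_group_E)
  obtain p q where pq: "f = Fract p q" "q \<noteq> 0" by (cases f) auto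
  then have "p \<noteq> 0" using f(1) by (auto simp: Zero_fract_def eq_fract)
  obtain h k where h: "h \<in> value_group v" and
    p: "germ_of (Fract p 1) (\<lambda>\<nu>. h + nmul k (gauge v z \<nu>))"
    using germ_of_Fract_1[OF \<open>p \<noteq> 0\<close>] by blast
  obtain h' k' where h': "h' \<in> value_group v" and
    q: "germ_of (Fract q 1) (\<lambda>\<nu>. h' + nmul k' (gauge v z \<nu>))"
    using germ_of_Fract_1[OF pq(2)] by blast
  have "f = Fract p 1 * inverse (Fract q 1)" using pq by simp
  then have "germ_of f (\<lambda>\<nu>. (h + nmul k (gauge v z \<nu>)) - (h' + nmul k' (gauge v z \<nu>)))"
    using germ_of_mult[OF p germ_of_inverse[OF q]] by (simp add: algebra_simps)
  then have g: "has_germ x (\<lambda>\<nu>. (h + nmul k (gauge v z \<nu>)) - (h' + nmul k' (gauge v z \<nu>)))"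
    using f unfolding has_germ_def by blast
  have sub: "h - h' \<in> value_group v" "h' - h \<in> value_group v"
    using h h' is_subgroup_value_group[OF v] by (simp_all add: is_subgroup_diff)
  show ?thesis
  proof (cases "k' \<le> k")
    case True
    then have "nmul k x = nmul k' x + nmul (k - k') x" for x :: 'g
      using nmul_add_left[of k' "k - k'" x] by simp
    then have "has_germ x (\<lambda>\<nu>. (h - h') + nmul (k - k') (gauge v z \<nu>))"
      using g by (simp add: algebra_simps)
    then show ?thesis using sub by blast
  next
    case False
    then have "nmul k' x = nmul k x + nmul (k' - k) x" for x :: 'g
      using nmul_add_left[of k "k' - k" x] by simp
    then have "has_germ (- x) (\<lambda>\<nu>. (h' - h) + nmul (k' - k) (gauge v z \<nu>))"
      using has_germ_minus[OF g] by (simp add: algebra_simps)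
    then show ?thesis using sub by blast
  qed
qed

lemma has_germ_gauge: "\<exists>x. has_germ x (gauge v z)"
proof -
  fix \<mu> :: 'o
  let ?p = "[:- z \<mu>, 1:]"
  have "\<forall>\<^sub>F \<nu> in at_top. poly ?p (z \<nu>) \<noteq> 0 \<and> v (poly ?p (z \<nu>)) = gauge v z \<nu>"
    using eventually_gt_at_top[of \<mu>]
  proof eventually_elim
    case (elim \<nu>)
    then have "z \<nu> - z \<mu> \<noteq> 0" using z unfolding pseudo_divergent_def by auto
    then show ?case using gauge_eq[OF v z elim] by simp
  qed
  then have "germ_of (Fract ?p 1) (gauge v z)" by (rule germ_of_poly)
  moreover have "Fract ?p 1 \<noteq> 0" by (simp add: Zero_fract_def eq_fract)
  ultimately show ?thesis unfolding has_germ_def by blast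
qed

text \<open>The inclusion of vK into the value group of \<open>w\<close>, expressed by germs; on
  \<open>value_group v\<close> it is pinned down by \<open>has_germ_unique\<close>.\<close>

definition const_value :: "'g \<Rightarrow> 'h" where
  "const_value h = (SOME x. has_germ x (\<lambda>_. h))"

lemma has_germ_const_value: "h \<in> value_group v \<Longrightarrow> has_germ (const_value h) (\<lambda>_. h)"
  unfolding const_value_def by (rule someI_ex[OF has_germ_const])

lemma const_value_pos:
  assumes "h \<in> value_group v" "0 < h"
  shows "0 < const_value h"
proof -
  have "has_germ 0 (\<lambda>_. 0)" by (simp add: has_germ_zero_iff)
  then have "\<not> const_value h \<le> 0"
    using has_germ_le_iff[OF has_germ_const_value[OF assms(1)]] assms(2) by simp
  then show ?thesis by simp
qed

lemma arch_le_const_value: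
  assumes "h \<in> value_group v" "k \<in> value_group v"
  shows "arch_le (const_value h) (const_value k) \<longleftrightarrow> arch_le h k"
  using arch_le_iff_germ[OF has_germ_const_value[OF assms(1)] has_germ_const_value[OF assms(2)]]
  unfolding arch_le_def[of h k] by (simp only: eventually_const[OF trivial_limit_at_top_linorder])

text \<open>Signs do not affect classes and \<open>k = 0\<close> gives a constant, so only elements
  that genuinely involve the gauge remain to be examined.\<close>

lemma value_group_cases:
  assumes x: "x \<in> value_group w" "x \<noteq> 0"
    and *: "\<And>y h k. h \<in> value_group v \<Longrightarrow> 0 < k \<Longrightarrow> y \<noteq> 0 \<Longrightarrow>
      has_germ y (\<lambda>\<nu>. h + nmul k (gauge v z \<nu>)) \<Longrightarrow>
      (\<exists>h\<in>value_group v. h \<noteq> 0 \<and> arch_eq y (const_value h)) \<or> arch_eq y \<rho>"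
  shows "(\<exists>h\<in>value_group v. h \<noteq> 0 \<and> arch_eq x (const_value h)) \<or> arch_eq x \<rho>"
proof -
  obtain h k where h: "h \<in> value_group v" and "has_germ x (\<lambda>\<nu>. h + nmul k (gauge v z \<nu>)) \<or>
      has_germ (- x) (\<lambda>\<nu>. h + nmul k (gauge v z \<nu>))"
    using value_group_germ[OF x(1)] by (elim bexE exE)
  then obtain y where y: "y = x \<or> y = - x" and g: "has_germ y (\<lambda>\<nu>. h + nmul k (gauge v z \<nu>))"
    by metis
  have y0: "y \<noteq> 0" using x y by auto
  have "(\<exists>h\<in>value_group v. h \<noteq> 0 \<and> arch_eq y (const_value h)) \<or> arch_eq y \<rho>"
  proof (cases "k = 0")
    case True
    then have "has_germ y (\<lambda>_. h)" using g by simp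
    then have "y = const_value h" "h \<noteq> 0"
      using has_germ_const_value[OF h] has_germ_unique y0 has_germ_zero_iff by auto
    then show ?thesis using h by force
  next
    case False
    then show ?thesis using *[OF h _ y0 g] by simp
  qed
  then show ?thesis using y by auto
qed

section \<open>Two criteria for the rank of the sequence valuation\<close>

lemma has_rank_same:
  assumes rank: "has_rank (value_group v) n"
    and *: "\<And>y h k. h \<in> value_group v \<Longrightarrow> 0 < k \<Longrightarrow> y \<noteq> 0 \<Longrightarrow>
      has_germ y (\<lambda>\<nu>. h + nmul k (gauge v z \<nu>)) \<Longrightarrow>
      \<exists>h\<in>value_group v. h \<noteq> 0 \<and> arch_eq y (const_value h)"
  shows "has_rank (value_group w) n"
proof -
  have "has_rank (value_group w) (n + card ({}::'h set))"
  proof (rule has_rank_embedding[where \<phi> = const_value and H = "value_group v"])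
    show "(\<exists>h\<in>value_group v. h \<noteq> 0 \<and> arch_eq x (const_value h)) \<or> (\<exists>a\<in>{}. arch_eq x a)"
      if x: "x \<in> value_group w" "x \<noteq> 0" for x
    proof -
      \<comment> \<open>Taking 0 for \<open>\<rho>\<close> empties the second alternative, since
        only 0 is equivalent to 0.\<close>
      have "(\<exists>h\<in>value_group v. h \<noteq> 0 \<and> arch_eq x (const_value h)) \<or> arch_eq x 0"
        by (rule value_group_cases[OF x]) (rule disjI1, rule *)
      then show ?thesis using x(2) by simp
    qed
  qed (use rank v w_valuation in \<open>auto simp: is_subgroup_value_group const_value_pos
      arch_eq_def arch_le_const_value arch_basis_def
      intro: has_germ_in_value_group[OF has_germ_const_value]\<close>)
  then show ?thesis by simp
qed

text \<open>After multiplication by \<open>m\<close>, every relevant element is a constant plus a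
  multiple of \<open>\<rho>\<close>. These two are never equivalent, so the larger one decides the
  class: an old class or that of \<open>\<rho>\<close>, and nothing else.\<close>

lemma has_rank_Suc:
  assumes rank: "has_rank (value_group v) n"
    and m: "0 < m" and g: "g \<in> value_group v"
    and \<rho>: "has_germ \<rho> (\<lambda>\<nu>. nmul m (gauge v z \<nu>) - g)"
    and indep: "\<And>h. h \<in> value_group v \<Longrightarrow> \<not> arch_eq \<rho> (const_value h)"
  shows "has_rank (value_group w) (n + 1)"
proof -
  let ?H = "value_group v"
  note H = is_subgroup_value_group[OF v] and G = is_subgroup_value_group[OF w_valuation]
  have "const_value 0 = 0"
    using has_germ_const_value[OF is_subgroup_0[OF H]] has_germ_zero_iff by simp
  then have \<rho>0: "\<rho> \<noteq> 0" using indep[OF is_subgroup_0[OF H]] by auto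
  then have \<rho>pos: "0 < mag \<rho>" using mag_nonneg[of \<rho>] mag_eq_0_iff[of \<rho>] less_le by metis
  have \<rho>G: "mag \<rho> \<in> value_group w"
    using is_subgroup_mag[OF G] has_germ_in_value_group[OF \<rho>] by blast
  have main: "(\<exists>h\<in>?H. h \<noteq> 0 \<and> arch_eq y (const_value h)) \<or> arch_eq y \<rho>"
    if h: "h \<in> ?H" and k: "0 < k" and y: "y \<noteq> 0" "has_germ y (\<lambda>\<nu>. h + nmul k (gauge v z \<nu>))"
    for y h k
  proof -
    \<comment> \<open>Obtained by solving m(h + k\<gamma>) = h' + k(m\<gamma> - g) for h'.\<close>
    define h' where "h' = nmul m h + nmul k g"
    have h': "h' \<in> ?H" unfolding h'_def using H h g by (intro is_subgroup_add is_subgroup_nmul)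
    have germ: "has_germ (nmul m y) (\<lambda>\<nu>. h' + nmul k (nmul m (gauge v z \<nu>) - g))"
      using has_germ_nmul[OF y(2), of m]
      by (simp add: h'_def nmul_add nmul_diff nmul_commute[of k m])
    have "has_germ (const_value h' + nmul k \<rho>) (\<lambda>\<nu>. h' + nmul k (nmul m (gauge v z \<nu>) - g))"
      by (intro has_germ_add has_germ_const_value h' has_germ_nmul \<rho>)
    then have eq: "nmul m y = const_value h' + nmul k \<rho>" using germ has_germ_unique by blast
    have k\<rho>: "arch_eq (nmul k \<rho>) \<rho>" using k by (rule arch_eq_nmul)
    have my: "arch_eq y (nmul m y)" using m arch_eq_nmul arch_eq_sym by blast
    show ?thesis
    proof (cases "h' = 0")
      case True
      then have "arch_eq (nmul m y) \<rho>" using eq k\<rho> \<open>const_value 0 = 0\<close> by simp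
      then show ?thesis using my arch_eq_trans by blast
    next
      case False
      have "\<not> arch_eq (nmul k \<rho>) (const_value h')"
        using indep[OF h'] k\<rho> arch_eq_trans arch_eq_sym by metis
      then consider "\<not> arch_le (const_value h') (nmul k \<rho>)" | "\<not> arch_le (nmul k \<rho>) (const_value h')"
        unfolding arch_eq_def by blast
      then show ?thesis
      proof cases
        case 1
        then have "arch_eq (nmul m y) (const_value h')" unfolding eq by (rule arch_eq_add)
        then show ?thesis using my h' False arch_eq_trans by blast
      next
        case 2
        then have "arch_eq (nmul m y) (nmul k \<rho>)" unfolding eq add.commute[of "const_value h'"]
          by (rule arch_eq_add)
        then show ?thesis using my k\<rho> arch_eq_trans by blast
      qed
    qed
  qed
  have "has_rank (value_group w) (n + card {mag \<rho>})"
  proof (rule has_rank_embedding[where \<phi> = const_value and H = ?H])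
    show "(\<exists>h\<in>?H. h \<noteq> 0 \<and> arch_eq x (const_value h)) \<or> (\<exists>a\<in>{mag \<rho>}. arch_eq x a)"
      if x: "x \<in> value_group w" "x \<noteq> 0" for x
    proof -
      have "(\<exists>h\<in>?H. h \<noteq> 0 \<and> arch_eq x (const_value h)) \<or> arch_eq x \<rho>"
        by (rule value_group_cases[OF x]) (rule main)
      then show ?thesis by simp
    qed
    show "\<not> arch_eq a (const_value h)" if "a \<in> {mag \<rho>}" "h \<in> ?H" for a h
      using that indep by auto
    show "arch_eq (const_value h) (const_value k) \<longleftrightarrow> arch_eq h k"
      if "h \<in> ?H" "k \<in> ?H" for h k
      using that by (simp add: arch_eq_def arch_le_const_value)
  qed (use rank H G \<rho>G \<rho>pos in \<open>auto simp: const_value_pos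
      intro: has_germ_in_value_group[OF has_germ_const_value]\<close>)
  then show ?thesis by simp
qed

end

section \<open>Lexicographic coordinates\<close>

text \<open>Terms of pairwise distinct value cannot cancel. It is applied in contrapositive form: in
  a vanishing sum, two terms share their value.\<close>

lemma valuation_sum_distinct:
  assumes v: "valuation v" and "finite A" "A \<noteq> {}"
    and "\<And>a. a \<in> A \<Longrightarrow> f a \<noteq> 0" and "inj_on (\<lambda>a. v (f a)) A"
  shows "sum f A \<noteq> 0 \<and> v (sum f A) \<in> (\<lambda>a. v (f a)) ` A"
  using assms(2-)
proof (induction rule: finite_ne_induct)
  case (insert a F)
  have IH: "sum f F \<noteq> 0" "v (sum f F) \<in> (\<lambda>a. v (f a)) ` F"
    using insert by (auto simp: inj_on_insert)
  have a: "f a \<noteq> 0" using insert by blast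
  have ne: "v (f a) \<noteq> v (sum f F)"
    using insert.prems(2) insert.hyps IH(2) by (auto simp: inj_on_def)
  have "v (f a + sum f F) = v (f a) \<or> v (f a + sum f F) = v (sum f F)"
    using valuation_add_eq[OF v a IH(1)] valuation_add_eq[OF v IH(1) a] ne
    by (metis add.commute linorder_neqE)
  then show ?case
    using valuation_sum_nonzero[OF v a IH(1) ne] insert.hyps IH(2) by auto
qed simp

section \<open>The value group of the algebraic closure: torsion over vK, and divisibility\<close>

lemma closure_embedding_nonzero:
  assumes "algebraic_closure_via \<iota>" "c \<noteq> 0"
  shows "\<iota> c \<noteq> 0"
proof
  assume "\<iota> c = 0"
  then have "\<iota> (c * inverse c) = 0" using assms(1) unfolding algebraic_closure_via_def by simp
  then show False using assms unfolding algebraic_closure_via_def by simp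
qed

text \<open>In a polynomial relation for \<open>y\<close> two terms, of degrees i < j, have equal
  value; comparing them expresses (j - i) x through values of coefficients.\<close>

lemma algebraic_closure_torsion:
  fixes \<iota> :: "'a::field \<Rightarrow> 'b::alg_closed_field"
  assumes v: "valuation v" and closure: "algebraic_closure_via \<iota>" and ext: "extends_valuation \<iota> v vbar"
    and x: "x \<in> value_group vbar"
  shows "\<exists>m>0. nmul m x \<in> value_group v"
proof -
  obtain y where y: "y \<noteq> 0" "vbar y = x" using x by (rule value_group_E)
  have vbar: "valuation vbar" and ext': "\<And>c. c \<noteq> 0 \<Longrightarrow> vbar (\<iota> c) = v c"
    using ext unfolding extends_valuation_def by auto
  have \<iota>: "\<iota> 1 = 1" "\<And>a b. \<iota> (a + b) = \<iota> a + \<iota> b" "\<And>a b. \<iota> (a * b) = \<iota> a * \<iota> b"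
    using closure unfolding algebraic_closure_via_def by auto
  have \<iota>0: "\<iota> 0 = 0" using \<iota>(2)[of 0 0] by (metis add.right_neutral add_left_cancel)
  have \<iota>nz: "\<iota> c \<noteq> 0" if "c \<noteq> 0" for c
    using closure_embedding_nonzero[OF closure that] .
  obtain p where p: "p \<noteq> 0" "poly (map_poly \<iota> p) y = 0"
    using closure unfolding algebraic_closure_via_def by blast
  \<comment> \<open>Vanishing coefficients are left out, because their value is unspecified.\<close>
  define A where "A = {i. i \<le> degree p \<and> coeff p i \<noteq> 0}"
  define f where "f i = \<iota> (coeff p i) * y ^ i" for i
  have A: "finite A" "A \<noteq> {}" using p(1) leading_coeff_0_iff[of p] by (auto simp: A_def)
  have f: "f i \<noteq> 0" if "i \<in> A" for i using that \<iota>nz y by (auto simp: f_def A_def)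
  have vf: "vbar (f i) = v (coeff p i) + nmul i x" if "i \<in> A" for i
    using that \<iota>nz y ext' valuation_mult[OF vbar] valuation_power[OF vbar]
    by (auto simp: f_def A_def)
  have "poly (map_poly \<iota> p) y = (\<Sum>i\<le>degree p. f i)"
    using \<iota>nz by (subst poly_altdef) (simp add: degree_map_poly coeff_map_poly \<iota>0 f_def)
  also have "\<dots> = sum f A"
    by (rule sum.mono_neutral_right) (auto simp: A_def f_def \<iota>0)
  finally have "sum f A = 0" using p(2) by simp
  then have "\<not> inj_on (\<lambda>i. vbar (f i)) A"
    using valuation_sum_distinct[OF vbar A, of f] f by blast
  then obtain i j where ij: "i \<in> A" "j \<in> A" "i < j" "vbar (f i) = vbar (f j)"
    unfolding inj_on_def by (metis linorder_neqE_nat)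
  then have "v (coeff p i) + nmul i x = v (coeff p j) + nmul (i + (j - i)) x" using vf by simp
  then have "nmul (j - i) x = v (coeff p i) - v (coeff p j)"
    unfolding nmul_add_left by (simp add: algebra_simps)
  then have "nmul (j - i) x \<in> value_group v"
    using ij(1,2) is_subgroup_value_group[OF v] unfolding A_def
    by (simp add: is_subgroup_diff value_group_I)
  then show ?thesis using ij(3) by (intro exI[of _ "j - i"]) simp
qed

lemma algebraically_closed_divisible:
  fixes vbar :: "'b::alg_closed_field \<Rightarrow> 'g::linordered_ab_group_add"
  assumes "valuation vbar" "x \<in> value_group vbar" "0 < m"
  shows "\<exists>y\<in>value_group vbar. nmul m y = x"
proof -
  obtain a where a: "a \<noteq> 0" "vbar a = x" using assms(2) by (rule value_group_E)
  obtain b where b: "b ^ m = a" using nth_root_exists[OF assms(3)] by blast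
  then have "b \<noteq> 0" using a(1) assms(3) by (auto simp: power_0_left)
  then show ?thesis using valuation_power[OF assms(1)] a b value_group_I by metis
qed

lemma ex_least_nonzero:
  fixes f :: "nat \<Rightarrow> real"
  assumes "\<exists>p<i. f p \<noteq> 0"
  shows "\<exists>p<i. f p \<noteq> 0 \<and> (\<forall>j<p. f j = 0)"
proof -
  obtain q where q: "q < i" "f q \<noteq> 0" using assms by blast
  define p where "p = (LEAST p. f p \<noteq> 0)"
  have "p \<le> q" "f p \<noteq> 0" unfolding p_def using q(2) by (rule Least_le, rule LeastI)
  moreover have "f j = 0" if "j < p" for j using not_less_Least[of j "\<lambda>p. f p \<noteq> 0"] that unfolding p_def by simp
  ultimately show ?thesis using q(1) by (intro exI[of _ p]) auto
qed

section \<open>Archimedean classes in lexicographic coordinates\<close>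

locale lex_group =
  fixes V :: "'g::linordered_ab_group_add set" and n :: nat and \<Gamma> :: "nat \<Rightarrow> real set"
    and \<theta> :: "'g \<Rightarrow> nat \<Rightarrow> real"
  assumes V: "is_subgroup V" and \<theta>: "lex_iso V n \<Gamma> \<theta>"
begin

lemma coord_add: "a \<in> V \<Longrightarrow> b \<in> V \<Longrightarrow> \<theta> (a + b) j = \<theta> a j + \<theta> b j"
  using \<theta> unfolding lex_iso_def by simp

lemma coord_zero: "\<theta> 0 j = 0"
  using coord_add[of 0 0] is_subgroup_0[OF V] by simp

lemma coord_minus: "a \<in> V \<Longrightarrow> \<theta> (- a) j = - \<theta> a j"
  using coord_add[of a "- a" j] is_subgroup_minus[OF V] by (simp add: coord_zero)

lemma coord_diff: "a \<in> V \<Longrightarrow> b \<in> V \<Longrightarrow> \<theta> (a - b) j = \<theta> a j - \<theta> b j"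
  using coord_add[of a "- b" j] coord_minus[of b j] is_subgroup_minus[OF V] by simp

lemma coord_nmul: "a \<in> V \<Longrightarrow> \<theta> (nmul m a) j = real m * \<theta> a j"
  by (induction m) (simp_all add: coord_zero coord_add is_subgroup_nmul[OF V] distrib_right)

lemma coord_in: "a \<in> V \<Longrightarrow> \<theta> a \<in> lex_sum n \<Gamma>"
  using \<theta> unfolding lex_iso_def bij_betw_def by blast

lemma coord_in_factor: "a \<in> V \<Longrightarrow> j \<in> {1..n} \<Longrightarrow> \<theta> a j \<in> \<Gamma> j"
  and coord_outside: "a \<in> V \<Longrightarrow> j \<notin> {1..n} \<Longrightarrow> \<theta> a j = 0"
  using coord_in unfolding lex_sum_def by blast+

lemma coord_surj: "x \<in> lex_sum n \<Gamma> \<Longrightarrow> \<exists>a\<in>V. \<theta> a = x"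
  using \<theta> unfolding lex_iso_def bij_betw_def by (metis imageE)

lemma less_iff_coord:
  "a \<in> V \<Longrightarrow> b \<in> V \<Longrightarrow> a < b \<longleftrightarrow> (\<exists>p. \<theta> a p < \<theta> b p \<and> (\<forall>j<p. \<theta> a j = \<theta> b j))"
  using \<theta> unfolding lex_iso_def less_fun_def by simp

lemma leading_coord:
  assumes "a \<in> V" "a \<noteq> 0"
  shows "\<exists>p\<in>{1..n}. \<theta> a p \<noteq> 0 \<and> (\<forall>j<p. \<theta> a j = 0)"
proof -
  have "a < 0 \<or> 0 < a" using assms(2) by auto
  then have "\<exists>p. \<theta> a p \<noteq> 0 \<and> (\<forall>j<p. \<theta> a j = 0)"
    using less_iff_coord[of a 0] less_iff_coord[of 0 a] assms(1) is_subgroup_0[OF V]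
    by (metis coord_zero less_irrefl)
  then show ?thesis using coord_outside[OF assms(1)] by blast
qed

text \<open>Passing to the magnitude flips all signs or none. If coordinate \<open>p\<close> is
  nonzero it leads and settles which; if it vanishes, both choices give 0 there.\<close>

lemma coord_mag:
  assumes a: "a \<in> V" and zero: "\<forall>j<p. \<theta> a j = 0"
  shows "\<theta> (mag a) p = \<bar>\<theta> a p\<bar>" "\<forall>j<p. \<theta> (mag a) j = 0"
proof -
  have 1: "a < 0" if "\<theta> a p < 0"
    using that zero less_iff_coord[OF a is_subgroup_0[OF V]] by (auto simp: coord_zero)
  have 2: "0 < a" if "0 < \<theta> a p"
    using that zero less_iff_coord[OF is_subgroup_0[OF V] a] by (auto simp: coord_zero)
  show "\<theta> (mag a) p = \<bar>\<theta> a p\<bar>"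
    using mag_cases[of a] 1 2 coord_minus[OF a, of p] by (cases "\<theta> a p" "0::real" rule: linorder_cases) auto
  show "\<forall>j<p. \<theta> (mag a) j = 0"
    using mag_cases[of a] zero coord_minus[OF a] by auto
qed

lemma nmul_mag_less:
  assumes a: "a \<in> V" "\<forall>j<p. \<theta> a j = 0" and b: "b \<in> V" "\<forall>j<p. \<theta> b j = 0"
    and less: "real k * \<bar>\<theta> a p\<bar> < real m * \<bar>\<theta> b p\<bar>"
  shows "nmul k (mag a) < nmul m (mag b)"
proof -
  have mem: "mag a \<in> V" "mag b \<in> V" using a b is_subgroup_mag[OF V] by auto
  then have "nmul k (mag a) \<in> V" "nmul m (mag b) \<in> V" by (simp_all add: is_subgroup_nmul[OF V])
  then show ?thesis
    unfolding less_iff_coord[OF \<open>nmul k (mag a) \<in> V\<close> \<open>nmul m (mag b) \<in> V\<close>]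
    using less coord_mag[OF a] coord_mag[OF b] by (intro exI[of _ p]) (simp add: coord_nmul mem)
qed

lemma arch_le_coord:
  assumes "a \<in> V" "\<forall>j<p. \<theta> a j = 0" "b \<in> V" "\<forall>j<p. \<theta> b j = 0" "\<theta> b p \<noteq> 0"
  shows "arch_le a b"
proof -
  obtain m where "\<bar>\<theta> a p\<bar> / \<bar>\<theta> b p\<bar> < real m" using reals_Archimedean2 by blast
  then have "real 1 * \<bar>\<theta> a p\<bar> < real m * \<bar>\<theta> b p\<bar>" using assms(5) by (simp add: divide_less_eq)
  then have "nmul 1 (mag a) < nmul m (mag b)" by (rule nmul_mag_less[OF assms(1-4)])
  then show ?thesis unfolding arch_le_def by (intro exI[of _ m]) simp
qed

text \<open>Elements with the same leading position dominate each other, so the n members of a basis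
  have distinct leading positions among n possible ones, and none is left out.\<close>

lemma ex_leading_coord:
  assumes H: "is_subgroup H" "H \<subseteq> V" and rank: "has_rank H n" and i: "i \<in> {1..n}"
  shows "\<exists>e\<in>H. \<theta> e i \<noteq> 0 \<and> (\<forall>j<i. \<theta> e j = 0)"
proof -
  obtain B where B: "arch_basis H B" "finite B" "card B = n"
    using rank has_rank_iff_arch_basis[OF H(1)] by blast
  have BH: "b \<in> H" "b \<noteq> 0" if "b \<in> B" for b using B(1) that unfolding arch_basis_def by blast+
  have "\<forall>b\<in>B. \<exists>p\<in>{1..n}. \<theta> b p \<noteq> 0 \<and> (\<forall>j<p. \<theta> b j = 0)"
    using leading_coord BH H(2) by blast
  then obtain l where l: "\<forall>b\<in>B. l b \<in> {1..n} \<and> \<theta> b (l b) \<noteq> 0 \<and> (\<forall>j<l b. \<theta> b j = 0)"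
    using bchoice[of B "\<lambda>b p. p \<in> {1..n} \<and> \<theta> b p \<noteq> 0 \<and> (\<forall>j<p. \<theta> b j = 0)"] by blast
  have "inj_on l B"
  proof (rule inj_onI)
    fix b c assume bc: "b \<in> B" "c \<in> B" "l b = l c"
    then have "arch_le b c" "arch_le c b"
      using l BH H(2) arch_le_coord[of b "l b" c] arch_le_coord[of c "l b" b] by (auto simp: subset_iff)
    then show "b = c" using B(1) bc unfolding arch_basis_def arch_eq_def by blast
  qed
  then have "l ` B = {1..n}"
    using l B by (intro card_subset_eq) (auto simp: card_image)
  then have "i \<in> l ` B" using i by simp
  then obtain b where "b \<in> B" "l b = i" by (elim imageE) simp
  then show ?thesis using l BH(1)[of b] by auto
qed

end

text \<open>The situation at stage \<open>i\<close>: from \<open>\<nu>0\<close> on, the gauge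
  coordinates before \<open>i\<close> are frozen at \<open>c\<close>. \<open>V\<close> is meant to
  be the value group of the closure, which enters further only through \<open>torsion\<close> and
  \<open>divisible\<close>.\<close>

locale sequence_valuation_lex =
  sequence_valuation v z w + lex_group V n \<Gamma> \<theta>
  for v :: "'a::field \<Rightarrow> 'g::linordered_ab_group_add"
    and z :: "'o::{wellorder,no_top} \<Rightarrow> 'a"
    and w :: "'a poly fract \<Rightarrow> 'h::linordered_ab_group_add"
    and V :: "'g set" and n :: nat and \<Gamma> :: "nat \<Rightarrow> real set" and \<theta> :: "'g \<Rightarrow> nat \<Rightarrow> real" +
  fixes i :: nat and \<nu>0 :: 'o and c :: "nat \<Rightarrow> real"
  assumes sub: "value_group v \<subseteq> V"
    and torsion: "x \<in> V \<Longrightarrow> \<exists>m>0. nmul m x \<in> value_group v"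
    and divisible: "x \<in> V \<Longrightarrow> 0 < m \<Longrightarrow> \<exists>y\<in>V. nmul m y = x"
    and \<Gamma>: "j \<in> {1..n} \<Longrightarrow> is_subgroup (\<Gamma> j)"
    and rank: "has_rank (value_group v) n"
    and i: "i \<in> {1..n}"
    and \<nu>0: "index_one \<le> \<nu>0"
    and c: "1 \<le> j \<Longrightarrow> j < i \<Longrightarrow> c j \<in> \<Gamma> j"
    and gauge_c: "1 \<le> j \<Longrightarrow> j < i \<Longrightarrow> \<nu>0 \<le> \<nu> \<Longrightarrow> \<theta> (gauge v z \<nu>) j = c j"
begin

abbreviation \<gamma> :: "'o \<Rightarrow> 'g" where "\<gamma> \<equiv> gauge v z"

lemma zero_in_factor: "j \<in> {1..n} \<Longrightarrow> 0 \<in> \<Gamma> j"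
  using \<Gamma> is_subgroup_0 by blast

lemma gauge_V: "\<nu>0 \<le> \<nu> \<Longrightarrow> \<gamma> \<nu> \<in> V"
  using gauge_in_value_group[OF v z] \<nu>0 sub by (meson order_trans subsetD)

lemma coord_gauge_antimono:
  assumes "\<nu>0 \<le> \<mu>" "\<mu> \<le> \<nu>"
  shows "\<theta> (\<gamma> \<nu>) i \<le> \<theta> (\<gamma> \<mu>) i"
proof (cases "\<mu> = \<nu>")
  case False
  have nu: "\<nu>0 \<le> \<nu>" using assms by simp
  have "\<gamma> \<nu> < \<gamma> \<mu>"
    using gauge_strict_antimono[OF v z, of \<mu> \<nu>] \<nu>0 assms False by simp
  then obtain p where p: "\<theta> (\<gamma> \<nu>) p < \<theta> (\<gamma> \<mu>) p" "\<forall>j<p. \<theta> (\<gamma> \<nu>) j = \<theta> (\<gamma> \<mu>) j"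
    using less_iff_coord[OF gauge_V[OF nu] gauge_V[OF assms(1)]] by blast
  \<comment> \<open>Position 0 lies outside the lexicographic sum, so both coordinates are 0
    there.\<close>
  have "1 \<le> p" using p(1) coord_outside gauge_V nu assms(1) by (cases p) auto
  then have "i \<le> p" using p(1) gauge_c[of p] nu assms(1) by (cases "p < i") auto
  then show ?thesis using p by (cases "i = p") (auto simp: less_imp_le)
qed simp

text \<open>This is why the last stage is never inconclusive: with all n coordinates frozen, no
  strict decrease of the gauges would be possible.\<close>

lemma coord_gauge_constant:
  assumes "i = n" "\<nu>0 \<le> \<mu>" "\<forall>\<nu>\<ge>\<mu>. \<theta> (\<gamma> \<nu>) n = r"
  shows False
proof -
  obtain \<nu> where \<nu>: "\<mu> < \<nu>" using gt_ex by blast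
  have nu: "\<nu>0 \<le> \<nu>" using assms(2) \<nu> by simp
  have "\<gamma> \<nu> < \<gamma> \<mu>"
    using gauge_strict_antimono[OF v z _ \<nu>] \<nu>0 assms(2) by simp
  then obtain p where p: "\<theta> (\<gamma> \<nu>) p < \<theta> (\<gamma> \<mu>) p"
    using less_iff_coord[OF gauge_V[OF nu] gauge_V[OF assms(2)]] by blast
  have "p \<in> {1..n}"
    using p coord_outside[OF gauge_V[OF nu], of p] coord_outside[OF gauge_V[OF assms(2)], of p]
    by (metis less_irrefl)
  then have "p = n \<or> \<theta> (\<gamma> \<nu>) p = \<theta> (\<gamma> \<mu>) p"
    using gauge_c[of p \<nu>] gauge_c[of p \<mu>] nu assms(1,2) by (cases "p = n") auto
  moreover have "\<theta> (\<gamma> \<nu>) n = \<theta> (\<gamma> \<mu>) n" using assms(3) \<nu> by (metis less_imp_le order_refl)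
  ultimately show False using p by auto
qed

lemma arch_le_germ_coord:
  assumes x: "has_germ x s" and y: "has_germ y t"
    and zero: "\<forall>\<^sub>F \<nu> in at_top. \<forall>j<p. \<theta> (s \<nu>) j = 0 \<and> \<theta> (t \<nu>) j = 0"
    and less: "\<forall>\<^sub>F \<nu> in at_top. \<bar>\<theta> (s \<nu>) p\<bar> < real m * \<bar>\<theta> (t \<nu>) p\<bar>"
  shows "arch_le x y"
proof -
  have "\<forall>\<^sub>F \<nu> in at_top. mag (s \<nu>) \<le> nmul m (mag (t \<nu>))"
    using zero less has_germ_eventually[OF x] has_germ_eventually[OF y]
  proof eventually_elim
    case (elim \<nu>)
    then have "nmul 1 (mag (s \<nu>)) < nmul m (mag (t \<nu>))"
      using sub by (intro nmul_mag_less) auto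
    then show ?case by simp
  qed
  then show ?thesis using arch_le_iff_germ[OF x y] by blast
qed

text \<open>A bound for every \<open>k\<close> is required, because a supposed domination comes with
  an unknown multiple \<open>m\<close>, which is then contradicted by \<open>k = m\<close>.\<close>

lemma not_arch_le_germ_coord:
  assumes x: "has_germ x s" and y: "has_germ y t"
    and zero: "\<forall>\<^sub>F \<nu> in at_top. \<forall>j<p. \<theta> (s \<nu>) j = 0 \<and> \<theta> (t \<nu>) j = 0"
    and less: "\<And>k::nat. \<forall>\<^sub>F \<nu> in at_top. real k * \<bar>\<theta> (s \<nu>) p\<bar> < \<bar>\<theta> (t \<nu>) p\<bar>"
  shows "\<not> arch_le y x"
proof
  assume "arch_le y x"
  then obtain m where m: "\<forall>\<^sub>F \<nu> in at_top. mag (t \<nu>) \<le> nmul m (mag (s \<nu>))"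
    using arch_le_iff_germ[OF y x] by blast
  have "\<forall>\<^sub>F \<nu>::'o in at_top. False"
    using m zero less[of m] has_germ_eventually[OF x] has_germ_eventually[OF y]
  proof eventually_elim
    case (elim \<nu>)
    then have "nmul m (mag (s \<nu>)) < nmul 1 (mag (t \<nu>))"
      using sub by (intro nmul_mag_less) auto
    then show ?case using elim(1) by simp
  qed
  then show False by simp
qed

text \<open>The lexicographic sum contains the point with entries \<open>c j\<close> before
  \<open>i\<close>, then \<open>q\<close>, then zeros. It belongs to the group \<open>V\<close>;
  torsion supplies the multiple that lies in vK. Subtracting \<open>g\<close> from m\<gamma> clears
  the coordinates before \<open>i\<close> and leaves m(\<gamma>_i - q) at \<open>i\<close>.\<close>

lemma center_exists:
  assumes "q \<in> \<Gamma> i"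
  shows "\<exists>m>0. \<exists>g\<in>value_group v. \<theta> g i = real m * q \<and>
    (\<forall>j<i. \<forall>\<nu>\<ge>\<nu>0. \<theta> g j = real m * \<theta> (\<gamma> \<nu>) j)"
proof -
  define a where "a j = (if 1 \<le> j \<and> j < i then c j else if j = i then q else 0)" for j
  have "a \<in> lex_sum n \<Gamma>"
    using c assms i zero_in_factor by (auto simp: a_def lex_sum_def)
  then obtain x where x: "x \<in> V" "\<theta> x = a" using coord_surj by blast
  then obtain m where m: "0 < m" "nmul m x \<in> value_group v" using torsion by blast
  have "a i = q" using i by (simp add: a_def)
  moreover have "a j = \<theta> (\<gamma> \<nu>) j" if "j < i" "\<nu>0 \<le> \<nu>" for j \<nu>
    using that gauge_c[of j \<nu>] coord_outside[OF gauge_V, of \<nu> j] by (cases "j = 0") (auto simp: a_def)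
  ultimately show ?thesis
    using m x coord_nmul[OF x(1)] by (intro exI[of _ m] conjI bexI[of _ "nmul m x"]) auto
qed

text \<open>By \<open>dichotomy\<close> the distance from \<open>q\<close> is incommensurable with
  every real \<open>t\<close>; with \<open>t\<close> the i-th coordinate of \<open>h\<close>, this
  separates \<open>\<rho>\<close> from constants that vanish before \<open>i\<close>. At
  \<open>t = 0\<close> only the second alternative can hold, so \<open>q\<close> is eventually
  avoided.\<close>

lemma has_rank_Suc_coord:
  assumes q: "q \<in> \<Gamma> i"
    and dichotomy: "\<And>t::real.
      (\<forall>k::nat. \<forall>\<^sub>F \<nu> in at_top. real k * \<bar>\<theta> (\<gamma> \<nu>) i - q\<bar> < \<bar>t\<bar>) \<or>
      (\<forall>k::nat. \<forall>\<^sub>F \<nu> in at_top. real k * \<bar>t\<bar> < \<bar>\<theta> (\<gamma> \<nu>) i - q\<bar>)"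
  shows "has_rank (value_group w) (n + 1)"
proof -
  obtain m g where m: "0 < m" and g: "g \<in> value_group v" "\<theta> g i = real m * q"
    "\<forall>j<i. \<forall>\<nu>\<ge>\<nu>0. \<theta> g j = real m * \<theta> (\<gamma> \<nu>) j"
    using center_exists[OF q] by blast
  define s where "s \<nu> = nmul m (\<gamma> \<nu>) - g" for \<nu>
  obtain \<tau> y where "has_germ \<tau> \<gamma>" "has_germ y (\<lambda>_. g)"
    using has_germ_gauge has_germ_const[OF g(1)] by blast
  then obtain \<rho> where \<rho>: "has_germ \<rho> s"
    unfolding s_def using has_germ_diff has_germ_nmul by blast
  have coord: "\<theta> (s \<nu>) j = real m * \<theta> (\<gamma> \<nu>) j - \<theta> g j" if "\<nu>0 \<le> \<nu>" for \<nu> j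
    using coord_diff[of "nmul m (\<gamma> \<nu>)" g j] coord_nmul gauge_V[OF that] g(1) sub
      is_subgroup_nmul[OF V] by (auto simp: s_def)
  have s0: "\<forall>\<^sub>F \<nu> in at_top. \<forall>j<i. \<theta> (s \<nu>) j = 0"
    using eventually_ge_at_top[of \<nu>0] by eventually_elim (use coord g(3) in auto)
  have si: "\<forall>\<^sub>F \<nu> in at_top. \<bar>\<theta> (s \<nu>) i\<bar> = real m * \<bar>\<theta> (\<gamma> \<nu>) i - q\<bar>"
    using eventually_ge_at_top[of \<nu>0]
  proof eventually_elim
    case (elim \<nu>)
    have "\<theta> (s \<nu>) i = real m * (\<theta> (\<gamma> \<nu>) i - q)"
      using coord[OF elim] g(2) by (simp add: right_diff_distrib)
    then show ?case by (simp add: abs_mult)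
  qed
  show ?thesis
  proof (rule has_rank_Suc[OF rank m g(1)])
    show "has_germ \<rho> (\<lambda>\<nu>. nmul m (\<gamma> \<nu>) - g)" using \<rho> unfolding s_def .
    fix h assume h: "h \<in> value_group v"
    note const = has_germ_const_value[OF h]
    show "\<not> arch_eq \<rho> (const_value h)"
    proof (cases "\<exists>p<i. \<theta> h p \<noteq> 0")
      case True
      obtain p where "p < i" and p: "\<theta> h p \<noteq> 0" and least: "\<forall>j<p. \<theta> h j = 0"
        using ex_least_nonzero[OF True] by blast
      \<comment> \<open>A constant that is nonzero before \<open>i\<close> exceeds all multiples of
        \<open>\<rho>\<close>, whose coordinates there vanish.\<close>
      have "\<not> arch_le (const_value h) \<rho>"
      proof (rule not_arch_le_germ_coord[OF \<rho> const, where p = p])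
        show "\<forall>\<^sub>F \<nu> in at_top. \<forall>j<p. \<theta> (s \<nu>) j = 0 \<and> \<theta> h j = 0"
          using s0 by eventually_elim (use \<open>p < i\<close> least in auto)
        show "\<forall>\<^sub>F \<nu> in at_top. real k * \<bar>\<theta> (s \<nu>) p\<bar> < \<bar>\<theta> h p\<bar>" for k :: nat
          using s0 by eventually_elim (use \<open>p < i\<close> p in auto)
      qed
      then show ?thesis by (simp add: arch_eq_def)
    next
      case False
      then have zero: "\<forall>\<^sub>F \<nu> in at_top. \<forall>j<i. \<theta> (s \<nu>) j = 0 \<and> \<theta> h j = 0"
        "\<forall>\<^sub>F \<nu> in at_top. \<forall>j<i. \<theta> h j = 0 \<and> \<theta> (s \<nu>) j = 0"
        using s0 by (auto elim: eventually_mono)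
      from dichotomy[of "\<theta> h i"] show ?thesis
      proof
        assume *: "\<forall>k::nat. \<forall>\<^sub>F \<nu> in at_top. real k * \<bar>\<theta> (\<gamma> \<nu>) i - q\<bar> < \<bar>\<theta> h i\<bar>"
        have "\<not> arch_le (const_value h) \<rho>"
        proof (rule not_arch_le_germ_coord[OF \<rho> const zero(1)])
          fix k :: nat
          show "\<forall>\<^sub>F \<nu> in at_top. real k * \<bar>\<theta> (s \<nu>) i\<bar> < \<bar>\<theta> h i\<bar>"
            \<comment> \<open>The factor \<open>m\<close> from \<open>si\<close> is absorbed into
              the multiple.\<close>
            using si *[rule_format, of "k * m"] by eventually_elim (simp add: mult.assoc)
        qed
        then show ?thesis by (simp add: arch_eq_def)
      next
        assume *: "\<forall>k::nat. \<forall>\<^sub>F \<nu> in at_top. real k * \<bar>\<theta> h i\<bar> < \<bar>\<theta> (\<gamma> \<nu>) i - q\<bar>"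
        have "\<not> arch_le \<rho> (const_value h)"
        proof (rule not_arch_le_germ_coord[OF const \<rho> zero(2)])
          fix k :: nat
          show "\<forall>\<^sub>F \<nu> in at_top. real k * \<bar>\<theta> h i\<bar> < \<bar>\<theta> (s \<nu>) i\<bar>"
            using si *[rule_format, of k]
          proof eventually_elim
            case (elim \<nu>)
            have "1 * \<bar>\<theta> (\<gamma> \<nu>) i - q\<bar> \<le> real m * \<bar>\<theta> (\<gamma> \<nu>) i - q\<bar>"
              using m by (intro mult_right_mono) auto
            then show ?case using elim by simp
          qed
        qed
        then show ?thesis by (simp add: arch_eq_def)
      qed
    qed
  qed
qed

section \<open>The three decisive cases at stage i\<close>

lemma has_rank_unbounded:
  assumes "\<And>K. \<exists>\<nu>\<ge>\<nu>0. \<theta> (\<gamma> \<nu>) i < K"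
  shows "has_rank (value_group w) (n + 1)"
proof (rule has_rank_Suc_coord)
  \<comment> \<open>The centre 0 is as good as any other: a coordinate tending to minus infinity
    leaves every bounded set.\<close>
  show "0 \<in> \<Gamma> i" using i by (rule zero_in_factor)
  have "\<forall>\<^sub>F \<nu> in at_top. real k * \<bar>t\<bar> < \<bar>\<theta> (\<gamma> \<nu>) i - 0\<bar>" for k :: nat and t :: real
  proof -
    obtain \<mu> where \<mu>: "\<nu>0 \<le> \<mu>" "\<theta> (\<gamma> \<mu>) i < - (real k * \<bar>t\<bar>)" using assms by blast
    show ?thesis
      using eventually_ge_at_top[of \<mu>]
      by eventually_elim (use \<mu> coord_gauge_antimono[OF \<mu>(1)] in force)
  qed
  then show "(\<forall>k::nat. \<forall>\<^sub>F \<nu> in at_top. real k * \<bar>\<theta> (\<gamma> \<nu>) i - 0\<bar> < \<bar>t\<bar>) \<or>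
      (\<forall>k::nat. \<forall>\<^sub>F \<nu> in at_top. real k * \<bar>t\<bar> < \<bar>\<theta> (\<gamma> \<nu>) i - 0\<bar>)" for t :: real
    by blast
qed

lemma eventually_coord_gauge_less:
  assumes "\<And>\<epsilon>. 0 < \<epsilon> \<Longrightarrow> \<exists>\<nu>\<ge>\<nu>0. \<theta> (\<gamma> \<nu>) i < r + \<epsilon>" and "0 < \<epsilon>"
  shows "\<forall>\<^sub>F \<nu> in at_top. \<theta> (\<gamma> \<nu>) i < r + \<epsilon>"
proof -
  obtain \<mu> where \<mu>: "\<nu>0 \<le> \<mu>" "\<theta> (\<gamma> \<mu>) i < r + \<epsilon>" using assms by blast
  show ?thesis
    using eventually_ge_at_top[of \<mu>]
    by eventually_elim (use \<mu> coord_gauge_antimono[OF \<mu>(1)] in force)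
qed

text \<open>The distance to \<open>r\<close> becomes smaller than every fraction of a nonzero
  \<open>t\<close>, yet stays positive, which settles \<open>t = 0\<close>.\<close>

lemma has_rank_unattained:
  assumes r: "r \<in> \<Gamma> i" and gt: "\<And>\<nu>. \<nu>0 \<le> \<nu> \<Longrightarrow> r < \<theta> (\<gamma> \<nu>) i"
    and inf: "\<And>\<epsilon>. 0 < \<epsilon> \<Longrightarrow> \<exists>\<nu>\<ge>\<nu>0. \<theta> (\<gamma> \<nu>) i < r + \<epsilon>"
  shows "has_rank (value_group w) (n + 1)"
proof (rule has_rank_Suc_coord[OF r])
  fix t :: real
  have "\<forall>\<^sub>F \<nu> in at_top. real k * \<bar>\<theta> (\<gamma> \<nu>) i - r\<bar> < \<bar>t\<bar>" if t: "t \<noteq> 0" for k :: nat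
  proof (cases "k = 0")
    case False
    have "\<forall>\<^sub>F \<nu> in at_top. \<theta> (\<gamma> \<nu>) i < r + \<bar>t\<bar> / real k"
      using inf False t by (intro eventually_coord_gauge_less) auto
    then show ?thesis
      using eventually_ge_at_top[of \<nu>0]
    proof eventually_elim
      case (elim \<nu>)
      then have "\<bar>\<theta> (\<gamma> \<nu>) i - r\<bar> < \<bar>t\<bar> / real k" using gt[of \<nu>] by simp
      then show ?case using False by (simp add: less_divide_eq mult.commute)
    qed
  qed (use t in simp)
  moreover have "\<forall>\<^sub>F \<nu> in at_top. real k * \<bar>0\<bar> < \<bar>\<theta> (\<gamma> \<nu>) i - r\<bar>" for k :: nat
    using eventually_ge_at_top[of \<nu>0] by eventually_elim (use gt in force)
  ultimately show "(\<forall>k::nat. \<forall>\<^sub>F \<nu> in at_top. real k * \<bar>\<theta> (\<gamma> \<nu>) i - r\<bar> < \<bar>t\<bar>) \<or>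
      (\<forall>k::nat. \<forall>\<^sub>F \<nu> in at_top. real k * \<bar>t\<bar> < \<bar>\<theta> (\<gamma> \<nu>) i - r\<bar>)"
    by (cases "t = 0") auto
qed

text \<open>Place \<open>a\<close> on the i-th coordinate axis, divide in \<open>V\<close>, and
  project back.\<close>

lemma factor_divisible:
  assumes "a \<in> \<Gamma> i" "0 < m"
  shows "a / real m \<in> \<Gamma> i"
proof -
  have "(\<lambda>j. if j = i then a else 0) \<in> lex_sum n \<Gamma>"
    using assms(1) i zero_in_factor by (auto simp: lex_sum_def)
  then obtain x where x: "x \<in> V" "\<theta> x = (\<lambda>j. if j = i then a else 0)" using coord_surj by blast
  then obtain y where y: "y \<in> V" "nmul m y = x" using divisible assms(2) by blast
  then have "real m * \<theta> y i = a" using coord_nmul[OF y(1), of m i] x by simp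
  then have "a / real m = \<theta> y i" using assms(2) by (simp add: field_simps)
  then show ?thesis using coord_in_factor[OF y(1) i] by simp
qed

text \<open>For each combination \<open>t\<close> either a coordinate before \<open>i\<close> leads,
  and it is that of a constant, or the i-th coordinate converges to some \<open>L\<close>.
  Divisibility of the factor forces \<open>L\<close> to be nonzero, so \<open>t\<close> falls into a
  class already present in vK.\<close>

lemma has_rank_not_in_factor:
  assumes r: "r \<notin> \<Gamma> i" and ge: "\<And>\<nu>. \<nu>0 \<le> \<nu> \<Longrightarrow> r \<le> \<theta> (\<gamma> \<nu>) i"
    and inf: "\<And>\<epsilon>. 0 < \<epsilon> \<Longrightarrow> \<exists>\<nu>\<ge>\<nu>0. \<theta> (\<gamma> \<nu>) i < r + \<epsilon>"
  shows "has_rank (value_group w) n"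
proof (rule has_rank_same[OF rank])
  fix y h k assume h: "h \<in> value_group v" and k: "0 < k" and y: "y \<noteq> 0"
    and germ: "has_germ y (\<lambda>\<nu>. h + nmul k (\<gamma> \<nu>))"
  have H: "is_subgroup (value_group v)" by (rule is_subgroup_value_group[OF v])
  obtain m g where m: "0 < m" and g: "g \<in> value_group v" "\<theta> g i = real m * 0"
    "\<forall>j<i. \<forall>\<nu>\<ge>\<nu>0. \<theta> g j = real m * \<theta> (\<gamma> \<nu>) j"
    using center_exists[OF zero_in_factor[OF i]] by blast
  \<comment> \<open>With centre 0, \<open>g\<close> imitates m\<gamma> before \<open>i\<close> and
    contributes nothing at \<open>i\<close>; hence \<open>h'\<close> agrees with \<open>t\<close>
    before \<open>i\<close>.\<close>
  define h' where "h' = nmul m h + nmul k g"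
  define t where "t \<nu> = nmul m (h + nmul k (\<gamma> \<nu>))" for \<nu>
  have h': "h' \<in> value_group v"
    unfolding h'_def using H h g(1) by (intro is_subgroup_add is_subgroup_nmul)
  have my: "has_germ (nmul m y) t" unfolding t_def by (rule has_germ_nmul[OF germ])
  have y_eq: "arch_eq y (nmul m y)" using m arch_eq_nmul arch_eq_sym by blast
  have t: "\<theta> (t \<nu>) j = real m * (\<theta> h j + real k * \<theta> (\<gamma> \<nu>) j)" if "\<nu>0 \<le> \<nu>" for \<nu> j
    using gauge_V[OF that] h sub is_subgroup_nmul[OF V] is_subgroup_add[OF V]
    by (auto simp: t_def coord_nmul coord_add subset_iff)
  have h'j: "\<theta> h' j = real m * \<theta> h j + real k * \<theta> g j" for j
    using g(1) h sub is_subgroup_nmul[OF V] is_subgroup_add[OF V]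
    by (auto simp: h'_def coord_nmul coord_add subset_iff)
  have tj: "\<theta> (t \<nu>) j = \<theta> h' j" if "\<nu>0 \<le> \<nu>" "j < i" for \<nu> j
    using t[OF that(1)] h'j g(3) that by (simp add: algebra_simps)
  have ti: "\<theta> (t \<nu>) i = \<theta> h' i + real (k * m) * \<theta> (\<gamma> \<nu>) i" if "\<nu>0 \<le> \<nu>" for \<nu>
    using t[OF that] h'j g(2) by (simp add: algebra_simps)
  show "\<exists>h\<in>value_group v. h \<noteq> 0 \<and> arch_eq y (const_value h)"
  proof (cases "\<exists>p<i. \<theta> h' p \<noteq> 0")
    case True
    obtain p where "p < i" and p: "\<theta> h' p \<noteq> 0" and least: "\<forall>j<p. \<theta> h' j = 0"
      using ex_least_nonzero[OF True] by blast
    note const = has_germ_const_value[OF h']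
    have z: "\<forall>\<^sub>F \<nu> in at_top. \<forall>j<p. \<theta> (t \<nu>) j = 0 \<and> \<theta> h' j = 0"
      "\<forall>\<^sub>F \<nu> in at_top. \<forall>j<p. \<theta> h' j = 0 \<and> \<theta> (t \<nu>) j = 0"
      using eventually_ge_at_top[of \<nu>0] by (eventually_elim, use tj least \<open>p < i\<close> in auto)+
    \<comment> \<open>Both coordinates at \<open>p\<close> are equal and nonzero; the factor 2
      merely makes the comparison strict.\<close>
    have "\<forall>\<^sub>F \<nu> in at_top. \<bar>\<theta> (t \<nu>) p\<bar> < real 2 * \<bar>\<theta> h' p\<bar>"
      "\<forall>\<^sub>F \<nu> in at_top. \<bar>\<theta> h' p\<bar> < real 2 * \<bar>\<theta> (t \<nu>) p\<bar>"
      using eventually_ge_at_top[of \<nu>0] by (eventually_elim, use tj p \<open>p < i\<close> in auto)+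
    then have "arch_eq (nmul m y) (const_value h')"
      unfolding arch_eq_def
      using arch_le_germ_coord[OF my const z(1)] arch_le_germ_coord[OF const my z(2)] by blast
    moreover have "h' \<noteq> 0" using p coord_zero by auto
    ultimately show ?thesis using h' y_eq arch_eq_trans by blast
  next
    case False
    \<comment> \<open>Full rank of vK provides a reference element whose leading position is
      \<open>i\<close>.\<close>
    obtain e where e: "e \<in> value_group v" "\<theta> e i \<noteq> 0" "\<forall>j<i. \<theta> e j = 0"
      using ex_leading_coord[OF H sub rank i] by blast
    note const = has_germ_const_value[OF e(1)]
    have z: "\<forall>\<^sub>F \<nu> in at_top. \<forall>j<i. \<theta> (t \<nu>) j = 0 \<and> \<theta> e j = 0"
      "\<forall>\<^sub>F \<nu> in at_top. \<forall>j<i. \<theta> e j = 0 \<and> \<theta> (t \<nu>) j = 0"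
      using eventually_ge_at_top[of \<nu>0] by (eventually_elim, use tj False e(3) in auto)+
    define L where "L = \<theta> h' i + real (k * m) * r"
    have km: "0 < k * m" using k m by simp
    have "L \<noteq> 0"
    proof
      assume "L = 0"
      then have "r = - (\<theta> h' i / real (k * m))" using km by (simp add: L_def field_simps)
      moreover have "\<theta> h' i \<in> \<Gamma> i" using coord_in_factor h' sub i by blast
      ultimately show False using r factor_divisible km is_subgroup_minus[OF \<Gamma>[OF i]] by metis
    qed
    \<comment> \<open>Chosen so that the deviation from \<open>L\<close>, scaled by
      \<open>k * m\<close>, stays below half of its absolute value.\<close>
    define \<epsilon> where "\<epsilon> = \<bar>L\<bar> / (2 * real (k * m))"
    have "0 < \<epsilon>" using \<open>L \<noteq> 0\<close> km by (simp add: \<epsilon>_def)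
    then have "\<forall>\<^sub>F \<nu> in at_top. \<theta> (\<gamma> \<nu>) i < r + \<epsilon>"
      using inf by (intro eventually_coord_gauge_less)
    then have bounds: "\<forall>\<^sub>F \<nu> in at_top. \<bar>L\<bar> / 2 < \<bar>\<theta> (t \<nu>) i\<bar> \<and> \<bar>\<theta> (t \<nu>) i\<bar> < 2 * \<bar>L\<bar>"
      using eventually_ge_at_top[of \<nu>0]
    proof eventually_elim
      case (elim \<nu>)
      have "\<theta> (t \<nu>) i - L = real (k * m) * (\<theta> (\<gamma> \<nu>) i - r)"
        using ti[OF elim(2)] by (simp add: L_def right_diff_distrib)
      moreover have "0 \<le> real (k * m) * (\<theta> (\<gamma> \<nu>) i - r)" using ge[OF elim(2)] by simp
      moreover have "real (k * m) * (\<theta> (\<gamma> \<nu>) i - r) < real (k * m) * \<epsilon>"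
        using elim(1) km by (intro mult_strict_left_mono) auto
      moreover have "real (k * m) * \<epsilon> = \<bar>L\<bar> / 2" using km by (simp add: \<epsilon>_def)
      ultimately show ?case by linarith
    qed
    obtain M1 :: nat where M1: "2 * \<bar>L\<bar> / \<bar>\<theta> e i\<bar> < real M1" using reals_Archimedean2 by blast
    obtain M2 :: nat where M2: "2 * \<bar>\<theta> e i\<bar> / \<bar>L\<bar> < real M2" using reals_Archimedean2 by blast
    have "\<forall>\<^sub>F \<nu> in at_top. \<bar>\<theta> (t \<nu>) i\<bar> < real M1 * \<bar>\<theta> e i\<bar>"
      using bounds
    proof eventually_elim
      case (elim \<nu>)
      have "2 * \<bar>L\<bar> < real M1 * \<bar>\<theta> e i\<bar>" using M1 e(2) by (simp add: divide_less_eq)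
      then show ?case using elim by linarith
    qed
    moreover have "\<forall>\<^sub>F \<nu> in at_top. \<bar>\<theta> e i\<bar> < real M2 * \<bar>\<theta> (t \<nu>) i\<bar>"
      using bounds
    proof eventually_elim
      case (elim \<nu>)
      have "\<bar>\<theta> e i\<bar> < real M2 * (\<bar>L\<bar> / 2)" using M2 \<open>L \<noteq> 0\<close> by (simp add: divide_less_eq)
      also have "\<dots> \<le> real M2 * \<bar>\<theta> (t \<nu>) i\<bar>" using elim by (intro mult_left_mono) auto
      finally show ?case .
    qed
    ultimately have "arch_eq (nmul m y) (const_value e)"
      unfolding arch_eq_def
      using arch_le_germ_coord[OF my const z(1)] arch_le_germ_coord[OF const my z(2)] by blast
    moreover have "e \<noteq> 0" using e(2) coord_zero by auto
    ultimately show ?thesis using e(1) y_eq arch_eq_trans by blast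
  qed
qed

end

section \<open>From the extended-real infimum to the cases\<close>

theorem mainTheorem9:
  fixes v :: "'a::field \<Rightarrow> 'g::linordered_ab_group_add"
    and \<iota> :: "'a \<Rightarrow> 'b::alg_closed_field"
    and vbar :: "'b \<Rightarrow> 'g"
    and \<Gamma> :: "nat \<Rightarrow> real set"
    and \<theta> :: "'g \<Rightarrow> nat \<Rightarrow> real"
    and z :: "'o::{wellorder,no_top} \<Rightarrow> 'a"
    and vE :: "'a poly fract \<Rightarrow> 'h::linordered_ab_group_add"
    and \<delta> :: "nat \<Rightarrow> 'o \<Rightarrow> real"
    and N :: "nat \<Rightarrow> 'o"
    and r :: "nat \<Rightarrow> real"
    and r' :: ereal
    and n i :: nat
  assumes v: "valuation v"
    and n: "0 < n" "has_rank (value_group v) n"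
    and closure: "algebraic_closure_via \<iota>"
    and vbar: "extends_valuation \<iota> v vbar"
    and \<Gamma>: "\<forall>j\<in>{1..n}. is_subgroup (\<Gamma> j)"
    and \<theta>: "lex_iso (value_group vbar) n \<Gamma> \<theta>"
    and z: "pseudo_divergent v z"
    and vE: "is_sequence_valuation v z vE"
    and \<delta>: "\<forall>j \<nu>. \<delta> j \<nu> = \<theta> (gauge v z \<nu>) j"
    and i: "1 \<le> i" "i \<le> n"
    and N0: "N 0 = index_one"
    and prev: "\<forall>j. 1 \<le> j \<and> j < i \<longrightarrow>
        r j \<in> \<Gamma> j \<and> N (j - 1) \<le> N j \<and>
        (INF \<nu>\<in>{N (j - 1)..}. ereal (\<delta> j \<nu>)) = ereal (r j) \<and>
        (\<forall>\<nu>\<ge>N j. \<delta> j \<nu> = r j)"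
    and r': "r' = (INF \<nu>\<in>{N (i - 1)..}. ereal (\<delta> i \<nu>))"
  shows
    "(r' = -\<infinity> \<longrightarrow> has_rank (value_group vE) (n + 1)) \<and>
     (r' \<in> ereal ` (UNIV - \<Gamma> i) \<longrightarrow> has_rank (value_group vE) n) \<and>
     (r' \<in> ereal ` \<Gamma> i \<and> (\<forall>\<nu>\<ge>N (i - 1). r' < ereal (\<delta> i \<nu>))
        \<longrightarrow> has_rank (value_group vE) (n + 1)) \<and>
     (\<not> (r' = -\<infinity>) \<and> \<not> (r' \<in> ereal ` (UNIV - \<Gamma> i)) \<and>
      \<not> (r' \<in> ereal ` \<Gamma> i \<and> (\<forall>\<nu>\<ge>N (i - 1). r' < ereal (\<delta> i \<nu>)))
        \<longrightarrow> r' \<in> ereal ` \<Gamma> i \<and>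
            (\<exists>\<nu>i. N (i - 1) \<le> \<nu>i \<and> (\<forall>\<nu>\<ge>\<nu>i. r' = ereal (\<delta> i \<nu>)))) \<and>
     (i = n \<longrightarrow>
        \<not> (r' \<in> ereal ` \<Gamma> i \<and>
           (\<exists>\<nu>i. N (i - 1) \<le> \<nu>i \<and> (\<forall>\<nu>\<ge>\<nu>i. r' = ereal (\<delta> i \<nu>)))))"
proof -
  have vbar': "valuation vbar" and ext: "\<And>x. x \<noteq> 0 \<Longrightarrow> vbar (\<iota> x) = v x"
    using vbar unfolding extends_valuation_def by auto
  note \<iota>nz = closure_embedding_nonzero[OF closure]
  have N_mono: "N a \<le> N b" if "a \<le> b" "b < i" for a b
    using that
  proof (induction rule: dec_induct)
    case (step k)
    then show ?case using prev[rule_format, of "Suc k"] by simp (meson order_trans)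
  qed simp
  have i': "i \<in> {1..n}" using i by simp
  interpret sequence_valuation_lex v z vE "value_group vbar" n \<Gamma> \<theta> i "N (i - 1)" r
  proof unfold_locales
    show "value_group v \<subseteq> value_group vbar"
      using ext \<iota>nz by (auto simp: value_group_def) (metis DiffI UNIV_I image_eqI singletonD)
    show "index_one \<le> N (i - 1)" using N_mono[of 0 "i - 1"] N0 i by simp
    \<comment> \<open>Coordinate \<open>j\<close> is frozen from \<open>N j\<close> on, and
      \<open>N j\<close> is at most \<open>N (i - 1)\<close> by monotonicity.\<close>
    show "\<theta> (gauge v z \<nu>) j = r j" if "1 \<le> j" "j < i" "N (i - 1) \<le> \<nu>" for j \<nu>
      using prev \<delta> that N_mono[of j "i - 1"] by force
  qed (use v z vE \<theta> n(2) i \<Gamma> prev vbar' is_subgroup_value_group[OF vbar']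
      algebraic_closure_torsion[OF v closure vbar] algebraically_closed_divisible[OF vbar'] in auto)
  let ?S = "{N (i - 1)..}"
  have \<delta>': "\<delta> j \<nu> = \<theta> (gauge v z \<nu>) j" for j \<nu> using \<delta> by blast
  have lower: "r' \<le> ereal (\<delta> i \<nu>)" if "N (i - 1) \<le> \<nu>" for \<nu>
    unfolding r' using that by (intro INF_lower) simp
  have approach: "\<exists>\<nu>\<ge>N (i - 1). \<delta> i \<nu> < K" if "r' < ereal K" for K
    using that unfolding r' INF_less_iff by auto
  have a: "has_rank (value_group vE) (n + 1)" if "r' = -\<infinity>"
    by (rule has_rank_unbounded) (use approach that \<delta>' in auto)
  have b: "has_rank (value_group vE) n" if r'x: "r' = ereal x" "x \<notin> \<Gamma> i" for x
  proof (rule has_rank_not_in_factor[OF r'x(2)])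
    show "x \<le> \<theta> (gauge v z \<nu>) i" if "N (i - 1) \<le> \<nu>" for \<nu>
      using lower[OF that] r'x(1) \<delta>' by simp
    show "\<exists>\<nu>\<ge>N (i - 1). \<theta> (gauge v z \<nu>) i < x + \<epsilon>" if "0 < \<epsilon>" for \<epsilon>
      using approach[of "x + \<epsilon>"] that r'x(1) \<delta>' by simp
  qed
  have c: "has_rank (value_group vE) (n + 1)"
    if r'x: "r' = ereal x" "x \<in> \<Gamma> i" "\<forall>\<nu>\<ge>N (i - 1). r' < ereal (\<delta> i \<nu>)" for x
  proof (rule has_rank_unattained[OF r'x(2)])
    show "x < \<theta> (gauge v z \<nu>) i" if "N (i - 1) \<le> \<nu>" for \<nu>
      using r'x(1,3) that \<delta>' by simp
    show "\<exists>\<nu>\<ge>N (i - 1). \<theta> (gauge v z \<nu>) i < x + \<epsilon>" if "0 < \<epsilon>" for \<epsilon>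
      using approach[of "x + \<epsilon>"] that r'x(1) \<delta>' by simp
  qed
  have d: "r' \<in> ereal ` \<Gamma> i \<and> (\<exists>\<nu>i. N (i - 1) \<le> \<nu>i \<and> (\<forall>\<nu>\<ge>\<nu>i. r' = ereal (\<delta> i \<nu>)))"
    if not: "r' \<noteq> -\<infinity>" "r' \<notin> ereal ` (UNIV - \<Gamma> i)"
      "\<not> (r' \<in> ereal ` \<Gamma> i \<and> (\<forall>\<nu>\<ge>N (i - 1). r' < ereal (\<delta> i \<nu>)))"
  proof -
    \<comment> \<open>Plus infinity is excluded because the infimum lies below a real gauge
      coordinate.\<close>
    obtain x where x: "r' = ereal x" using not(1) lower[of "N (i - 1)"] by (cases r') auto
    then have mem: "r' \<in> ereal ` \<Gamma> i" using not(2) by blast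
    \<comment> \<open>Failure of strictness yields an index where the infimum is attained; from
      there on the decreasing coordinate is caught between the infimum and itself.\<close>
    then obtain \<mu> where \<mu>: "N (i - 1) \<le> \<mu>" "\<delta> i \<mu> \<le> x" using not(3) x by force
    have "r' = ereal (\<delta> i \<nu>)" if "\<mu> \<le> \<nu>" for \<nu>
      using coord_gauge_antimono[OF \<mu>(1) that] lower[OF order_trans[OF \<mu>(1) that]] \<mu>(2) x \<delta>' by simp
    then show ?thesis using mem \<mu>(1) by blast
  qed
  have e: False if "i = n" and "N (i - 1) \<le> \<mu>" and "\<forall>\<nu>\<ge>\<mu>. r' = ereal (\<delta> i \<nu>)" for \<mu>
  proof (rule coord_gauge_constant[OF that(1,2)])
    show "\<forall>\<nu>\<ge>\<mu>. \<theta> (gauge v z \<nu>) n = \<delta> i \<mu>" using that \<delta>' by (metis ereal.inject order_refl)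
  qed
  show ?thesis using a b c d e by blast
qed

end
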